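(* Let $F^{n}=(M^{n},L)$ be a Finsler space, let $b_i(x,y)$ be an $h$-vector in $F^n$, and let ${}^{*}F^{n}=(M^{n},{}^{*}L)$ be the Finsler space obtained by the Kropina change with $h$-vector ${}^{*}L(x,y)=L^2(x,y)/(b_i(x,y)y^i)$. Let $F^{n-1}$ and ${}^{*}F^{n-1}$ be the Finslerian hypersurfaces of $F^n$ and ${}^{*}F^n$, respectively, with the same underlying hypersurface $M^{n-1}$ of $M^n$. Suppose that the $h$-vector $b_i(x,y)$ is a gradient and is tangent to the hypersurface $F^{n-1}$. Then $F^{n-1}$ is a hyperplane of the first kind if and only if ${}^{*}F^{n-1}$ is a hyperplane of the first kind.
   Context: Notation: $\partial_i=\partial/\partial x^i$, $\dot\partial_i=\partial/\partial y^i$; the summation convention is used. Latin indices run over $1,\dots,n$, Greek indices over $1,\dots,n-1$. Finsler space: $F^n=(M^n,L)$ is an $n$-dimensional smooth manifold with Finsler metric function $L(x,y)$. Set $l_i=\dot\partial_iL$, $g_{ij}=\tfrac12\dot\partial_i\dot\partial_jL^2$, $h_{ij}=L\,\dot\partial_i\dot\partial_jL$, $C_{ijk}=\tfrac12\dot\partial_kg_{ij}$, $C^{h}_{ij}=g^{hk}C_{ijk}$. Cartan connection $C\Gamma=(F^i_{jk},G^i_j,C^i_{jk})$ of $F^n$: $G^i=\tfrac14g^{ir}(y^j\dot\partial_r\partial_jL^2-\partial_rL^2)$, $G^i_j=\dot\partial_jG^i$, and with $\delta_k=\partial_k-G^h_k\dot\partial_h$, $F^i_{jk}=\tfrac12g^{ir}(\delta_kg_{rj}+\delta_jg_{rk}-\delta_rg_{jk})$.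 For a covariant vector field $X_i(x,y)$ the $h$- and $v$-covariant derivatives are $X_{i|j}=\partial_jX_i-(\dot\partial_hX_i)G^h_j-F^r_{ij}X_r$ and $X_i|_j=\dot\partial_jX_i-C^r_{ij}X_r$. $h$-vector: $b_i(x,y)$ is an $h$-vector in $F^n$ if (i) $b_i|_k=0$ and (ii) $L\,C^h_{ij}b_h=\rho\,h_{ij}$ for a scalar function $\rho\neq0$. (By a known result of Izumi, $\rho$ is independent of $y$.) It is a gradient if $b_{i|j}=b_{j|i}$. Kropina change: put $\beta=b_iy^i$ (nonzero where ${}^{*}L$ is considered). ${}^{*}F^n=(M^n,{}^{*}L)$ is assumed to be a Finsler space; quantities marked with an asterisk are those formed from ${}^{*}L$ in the same way. Hypersurface: $M^{n-1}$ is given by $x^i=x^i(u^\alpha)$, with $B^i_\alpha=\partial x^i/\partial u^\alpha$ of rank $n-1$; the supporting element is tangent to $M^{n-1}$: $y^i=B^i_\alpha(u)v^\alpha$. $F^{n-1}=(M^{n-1},\underline L)$ with $\underline L(u,v)=L(x(u),y(u,v))$, and ${}^{*}F^{n-1}=(M^{n-1},{}^{*}\underline L)$ with ${}^{*}\underline L(u,v)={}^{*}L(x(u),y(u,v))$. Ambient quantities are evaluated at $(x(u),y(u,v))$. The unit normal $N^i(u,v)$ of $F^{n-1}$ is defined by $g_{ij}B^i_\alpha N^j=0$, $g_{ij}N^iN^j=1$, and $N_i=g_{ij}N^j$; similarly ${}^{*}N^i$ for ${}^{*}F^{n-1}$ using ${}^{*}g_{ij}$, and ${}^{*}N_i={}^{*}g_{ij}{}^{*}N^j$.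 The vector $b_i$ is tangent to $F^{n-1}$ if $b_iN^i=0$ along $F^{n-1}$. Normal curvature vector: $H_\alpha=N_i(B^i_{0\alpha}+G^i_jB^j_\alpha)$, where $B^i_{\alpha\beta}=\partial^2x^i/\partial u^\alpha\partial u^\beta$ and $B^i_{0\alpha}=B^i_{\beta\alpha}v^\beta$; $H_0=H_\alpha v^\alpha$. For ${}^{*}F^{n-1}$: ${}^{*}H_\alpha={}^{*}N_i(B^i_{0\alpha}+{}^{*}G^i_jB^j_\alpha)$. Hyperplane of the first kind: $F^{n-1}$ is a hyperplane of the first kind if and only if $H_\alpha=0$ for all $\alpha$, equivalently $H_0=0$ (Matsumoto's characterization, to be taken as the definition); likewise for ${}^{*}F^{n-1}$ with ${}^{*}H_\alpha$. *)

theory Defs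
  imports "HOL-Analysis.Analysis"
begin

section \<open>Smoothness and partial derivatives\<close>

text \<open>Only used on open sets. On finite-dimensional domains \<open>Ck_on k f S\<close> is the usual
  class \<open>C^k\<close>: all iterated directional derivatives up to order \<open>k\<close> are continuous.\<close>

primrec Ck_on :: "nat \<Rightarrow> ('a::real_normed_vector \<Rightarrow> 'b::real_normed_vector) \<Rightarrow> 'a set \<Rightarrow> bool" where
  "Ck_on 0 f S \<longleftrightarrow> continuous_on S f"
| "Ck_on (Suc k) f S \<longleftrightarrow>
     (\<forall>x\<in>S. f differentiable (at x)) \<and> (\<forall>v. Ck_on k (\<lambda>x. frechet_derivative f (at x) v) S)"

definition smooth_on :: "'a set \<Rightarrow> ('a::real_normed_vector \<Rightarrow> 'b::real_normed_vector) \<Rightarrow> bool" where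
  "smooth_on S f \<longleftrightarrow> (\<forall>k. Ck_on k f S)"

definition partial :: "'k::finite \<Rightarrow> (real^'k \<Rightarrow> real) \<Rightarrow> real^'k \<Rightarrow> real" where
  "partial i f x = frechet_derivative f (at x) (axis i 1)"

text \<open>A function of a point \<open>x\<close> and a supporting element \<open>y\<close>, in a chart; \<open>dx i\<close> and \<open>dy i\<close>
  are the derivatives with respect to \<open>x^i\<close> and \<open>y^i\<close>.\<close>

type_synonym 'n xyfun = "real^'n \<Rightarrow> real^'n \<Rightarrow> real"

definition dx :: "'n::finite \<Rightarrow> 'n xyfun \<Rightarrow> 'n xyfun" where
  "dx i f x y = partial i (\<lambda>x'. f x' y) x"

definition dy :: "'n::finite \<Rightarrow> 'n xyfun \<Rightarrow> 'n xyfun" where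
  "dy i f x y = partial i (\<lambda>y'. f x y') y"

section \<open>Finsler tensors and the Cartan connection in a chart\<close>

definition gmet :: "'n::finite xyfun \<Rightarrow> 'n \<Rightarrow> 'n \<Rightarrow> 'n xyfun" where
  "gmet L i j x y = 1/2 * dy i (dy j (\<lambda>x y. (L x y)^2)) x y"

definition ginv :: "'n::finite xyfun \<Rightarrow> 'n \<Rightarrow> 'n \<Rightarrow> 'n xyfun" where
  "ginv L i j x y = matrix_inv (\<chi> k l. gmet L k l x y) $ i $ j"

definition hang :: "'n::finite xyfun \<Rightarrow> 'n \<Rightarrow> 'n \<Rightarrow> 'n xyfun" where
  "hang L i j x y = L x y * dy i (dy j L) x y"

text \<open>\<open>Clow L i j k\<close> is \<open>C_{ijk}\<close> and \<open>Cup L h i j\<close> is \<open>C^h_{ij}\<close>.\<close>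

definition Clow :: "'n::finite xyfun \<Rightarrow> 'n \<Rightarrow> 'n \<Rightarrow> 'n \<Rightarrow> 'n xyfun" where
  "Clow L i j k x y = 1/2 * dy k (gmet L i j) x y"

definition Cup :: "'n::finite xyfun \<Rightarrow> 'n \<Rightarrow> 'n \<Rightarrow> 'n \<Rightarrow> 'n xyfun" where
  "Cup L h i j x y = (\<Sum>k\<in>UNIV. ginv L h k x y * Clow L i j k x y)"

definition spray :: "'n::finite xyfun \<Rightarrow> 'n \<Rightarrow> 'n xyfun" where
  "spray L i x y = 1/4 * (\<Sum>r\<in>UNIV. ginv L i r x y *
     ((\<Sum>j\<in>UNIV. y $ j * dy r (dx j (\<lambda>x y. (L x y)^2)) x y) - dx r (\<lambda>x y. (L x y)^2) x y))"

text \<open>\<open>nonlin L i j\<close> is \<open>G^i_j\<close>, \<open>hconn L i j k\<close> is \<open>F^i_{jk}\<close>.\<close>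

definition nonlin :: "'n::finite xyfun \<Rightarrow> 'n \<Rightarrow> 'n \<Rightarrow> 'n xyfun" where
  "nonlin L i j = dy j (spray L i)"

definition delta :: "'n::finite xyfun \<Rightarrow> 'n \<Rightarrow> 'n xyfun \<Rightarrow> 'n xyfun" where
  "delta L k f x y = dx k f x y - (\<Sum>h\<in>UNIV. nonlin L h k x y * dy h f x y)"

definition hconn :: "'n::finite xyfun \<Rightarrow> 'n \<Rightarrow> 'n \<Rightarrow> 'n \<Rightarrow> 'n xyfun" where
  "hconn L i j k x y = 1/2 * (\<Sum>r\<in>UNIV. ginv L i r x y *
     (delta L k (gmet L r j) x y + delta L j (gmet L r k) x y - delta L r (gmet L j k) x y))"

text \<open>Covariant derivatives \<open>X_{i|j}\<close> and \<open>X_i|_j\<close> of a covariant vector field with components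
  \<open>X x y $ i\<close>.\<close>

definition hcov :: "'n::finite xyfun \<Rightarrow> (real^'n \<Rightarrow> real^'n \<Rightarrow> real^'n) \<Rightarrow> 'n \<Rightarrow> 'n \<Rightarrow> 'n xyfun" where
  "hcov L X i j x y =
     dx j (\<lambda>x y. X x y $ i) x y
     - (\<Sum>h\<in>UNIV. dy h (\<lambda>x y. X x y $ i) x y * nonlin L h j x y)
     - (\<Sum>r\<in>UNIV. hconn L r i j x y * X x y $ r)"

definition vcov :: "'n::finite xyfun \<Rightarrow> (real^'n \<Rightarrow> real^'n \<Rightarrow> real^'n) \<Rightarrow> 'n \<Rightarrow> 'n \<Rightarrow> 'n xyfun" where
  "vcov L X i j x y =
     dy j (\<lambda>x y. X x y $ i) x y - (\<Sum>r\<in>UNIV. Cup L r i j x y * X x y $ r)"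

section \<open>Smooth manifolds and Finsler spaces\<close>

text \<open>A chart is a pair of its domain and its coordinate map (the values of the map outside the
  domain are irrelevant). The manifold is the whole type \<open>'p\<close>, whose topology is required to be
  Hausdorff and second countable.\<close>

type_synonym ('p, 'n) chart = "'p set \<times> ('p \<Rightarrow> real^'n)"

definition chart_inv :: "('p, 'n::finite) chart \<Rightarrow> real^'n \<Rightarrow> 'p" where
  "chart_inv c = inv_into (fst c) (snd c)"

text \<open>Transition map from \<open>c\<close>-coordinates to \<open>d\<close>-coordinates, meaningful on \<open>overlap c d\<close>.\<close>

definition overlap :: "('p, 'n::finite) chart \<Rightarrow> ('p, 'n) chart \<Rightarrow> (real^'n) set" where
  "overlap c d = snd c ` (fst c \<inter> fst d)"

definition transition :: "('p, 'n::finite) chart \<Rightarrow> ('p, 'n) chart \<Rightarrow> real^'n \<Rightarrow> real^'n" where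
  "transition c d = snd d \<circ> chart_inv c"

definition dtransition :: "('p, 'n::finite) chart \<Rightarrow> ('p, 'n) chart \<Rightarrow> real^'n \<Rightarrow> real^'n \<Rightarrow> real^'n" where
  "dtransition c d x = frechet_derivative (transition c d) (at x)"

definition smooth_atlas ::
  "('p::{t2_space,second_countable_topology}, 'n::finite) chart set \<Rightarrow> bool" where
  "smooth_atlas A \<longleftrightarrow>
     (\<Union>c\<in>A. fst c) = UNIV \<and>
     (\<forall>c\<in>A. open (fst c) \<and> open (snd c ` fst c) \<and>
        homeomorphism (fst c) (snd c ` fst c) (snd c) (chart_inv c)) \<and>
     (\<forall>c\<in>A. \<forall>d\<in>A. smooth_on (overlap c d) (transition c d))"

text \<open>Objects on the tangent bundle are given, as in classical tensor calculus, by their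
  representatives in all charts of the atlas together with the transformation law. The set of
  admissible supporting elements is an open conic subset of the slit tangent bundle; the whole slit
  tangent bundle is allowed, but a Kropina metric is singular where \<open>\<beta> = 0\<close>.\<close>

definition conic_domain ::
  "('p, 'n::finite) chart set \<Rightarrow> (('p, 'n) chart \<Rightarrow> ((real^'n) \<times> (real^'n)) set) \<Rightarrow> bool" where
  "conic_domain A D \<longleftrightarrow>
     (\<forall>c\<in>A. open (D c) \<and> D c \<subseteq> (snd c ` fst c) \<times> (- {0}) \<and>
        (\<forall>x\<in>snd c ` fst c. \<exists>y. (x, y) \<in> D c) \<and>
        (\<forall>x y t. (x, y) \<in> D c \<and> t > 0 \<longrightarrow> (x, t *\<^sub>R y) \<in> D c)) \<and>
     (\<forall>c\<in>A. \<forall>d\<in>A. \<forall>x\<in>overlap c d. \<forall>y.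
        (x, y) \<in> D c \<longleftrightarrow> (transition c d x, dtransition c d x y) \<in> D d)"

definition scalar_field ::
  "('p, 'n::finite) chart set \<Rightarrow> (('p, 'n) chart \<Rightarrow> ((real^'n) \<times> (real^'n)) set)
     \<Rightarrow> (('p, 'n) chart \<Rightarrow> 'n xyfun) \<Rightarrow> bool" where
  "scalar_field A D f \<longleftrightarrow>
     (\<forall>c\<in>A. \<forall>d\<in>A. \<forall>x\<in>overlap c d. \<forall>y. (x, y) \<in> D c \<longrightarrow>
        f c x y = f d (transition c d x) (dtransition c d x y))"

definition covector_field ::
  "('p, 'n::finite) chart set \<Rightarrow> (('p, 'n) chart \<Rightarrow> ((real^'n) \<times> (real^'n)) set)
     \<Rightarrow> (('p, 'n) chart \<Rightarrow> real^'n \<Rightarrow> real^'n \<Rightarrow> real^'n) \<Rightarrow> bool" where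
  "covector_field A D b \<longleftrightarrow>
     (\<forall>c\<in>A. smooth_on (D c) (\<lambda>(x, y). b c x y)) \<and>
     (\<forall>c\<in>A. \<forall>d\<in>A. \<forall>x\<in>overlap c d. \<forall>y. (x, y) \<in> D c \<longrightarrow>
        (\<forall>w. b c x y \<bullet> w =
             b d (transition c d x) (dtransition c d x y) \<bullet> dtransition c d x w))"

text \<open>Strong convexity gives \<open>L^2 = g_{ij} y^i y^j > 0\<close>, so \<open>L\<close> has no zeros on \<open>D\<close>. Its sign is
  deliberately left free, because \<open>L^2/\<beta>\<close> is negative where \<open>\<beta> < 0\<close>; metrics with
  \<open>L > 0\<close> are included.\<close>

definition finsler_metric :: "((real^'n) \<times> (real^'n)) set \<Rightarrow> 'n::finite xyfun \<Rightarrow> bool" where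
  "finsler_metric D L \<longleftrightarrow>
     smooth_on D (\<lambda>(x, y). L x y) \<and>
     (\<forall>x y t. (x, y) \<in> D \<and> t > 0 \<longrightarrow> L x (t *\<^sub>R y) = t * L x y) \<and>
     (\<forall>x y w. (x, y) \<in> D \<and> w \<noteq> 0 \<longrightarrow>
        (\<Sum>i\<in>UNIV. \<Sum>j\<in>UNIV. gmet L i j x y * w $ i * w $ j) > 0)"

definition finsler_space ::
  "('p::{t2_space,second_countable_topology}, 'n::finite) chart set
     \<Rightarrow> (('p, 'n) chart \<Rightarrow> ((real^'n) \<times> (real^'n)) set) \<Rightarrow> (('p, 'n) chart \<Rightarrow> 'n xyfun) \<Rightarrow> bool" where
  "finsler_space A D L \<longleftrightarrow>
     smooth_atlas A \<and> conic_domain A D \<and> scalar_field A D L \<and>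
     (\<forall>c\<in>A. finsler_metric (D c) (L c))"

section \<open>h-vectors and the Kropina change\<close>

definition h_vector ::
  "('p, 'n::finite) chart set \<Rightarrow> (('p, 'n) chart \<Rightarrow> ((real^'n) \<times> (real^'n)) set)
     \<Rightarrow> (('p, 'n) chart \<Rightarrow> 'n xyfun) \<Rightarrow> (('p, 'n) chart \<Rightarrow> real^'n \<Rightarrow> real^'n \<Rightarrow> real^'n) \<Rightarrow> bool" where
  "h_vector A D L b \<longleftrightarrow>
     covector_field A D b \<and>
     (\<forall>c\<in>A. \<forall>(x, y)\<in>D c. \<forall>i k. vcov (L c) (b c) i k x y = 0) \<and>
     (\<exists>\<rho>. scalar_field A D \<rho> \<and>
        (\<forall>c\<in>A. \<forall>(x, y)\<in>D c. \<rho> c x y \<noteq> 0 \<and>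
           (\<forall>i j. L c x y * (\<Sum>h\<in>UNIV. Cup (L c) h i j x y * b c x y $ h) =
                  \<rho> c x y * hang (L c) i j x y)))"

definition gradient_covector ::
  "('p, 'n::finite) chart set \<Rightarrow> (('p, 'n) chart \<Rightarrow> ((real^'n) \<times> (real^'n)) set)
     \<Rightarrow> (('p, 'n) chart \<Rightarrow> 'n xyfun) \<Rightarrow> (('p, 'n) chart \<Rightarrow> real^'n \<Rightarrow> real^'n \<Rightarrow> real^'n) \<Rightarrow> bool" where
  "gradient_covector A D L b \<longleftrightarrow>
     (\<forall>c\<in>A. \<forall>(x, y)\<in>D c. \<forall>i j. hcov (L c) (b c) i j x y = hcov (L c) (b c) j i x y)"

definition kropina_metric ::
  "(('p, 'n::finite) chart \<Rightarrow> 'n xyfun) \<Rightarrow> (('p, 'n) chart \<Rightarrow> real^'n \<Rightarrow> real^'n \<Rightarrow> real^'n)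
     \<Rightarrow> (('p, 'n) chart \<Rightarrow> 'n xyfun)" where
  "kropina_metric L b c x y = (L c x y)^2 / (\<Sum>i\<in>UNIV. b c x y $ i * y $ i)"

definition kropina_domain ::
  "(('p, 'n::finite) chart \<Rightarrow> ((real^'n) \<times> (real^'n)) set)
     \<Rightarrow> (('p, 'n) chart \<Rightarrow> real^'n \<Rightarrow> real^'n \<Rightarrow> real^'n)
     \<Rightarrow> (('p, 'n) chart \<Rightarrow> ((real^'n) \<times> (real^'n)) set)" where
  "kropina_domain D b c = {(x, y) \<in> D c. (\<Sum>i\<in>UNIV. b c x y $ i * y $ i) \<noteq> 0}"

section \<open>Hypersurfaces\<close>

text \<open>Below, \<open>X\<close> is a local parametrization \<open>x^i = x^i(u)\<close>; \<open>Bproj X i \<alpha>\<close> is \<open>B^i_\<alpha>\<close> and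
  \<open>Bproj2 X i \<alpha> \<beta>\<close> is \<open>B^i_{\<alpha>\<beta>}\<close>.\<close>

definition Bproj :: "(real^'m::finite \<Rightarrow> real^'n::finite) \<Rightarrow> 'n \<Rightarrow> 'm \<Rightarrow> real^'m \<Rightarrow> real" where
  "Bproj X i \<alpha> u = partial \<alpha> (\<lambda>u'. X u' $ i) u"

definition Bproj2 :: "(real^'m::finite \<Rightarrow> real^'n::finite) \<Rightarrow> 'n \<Rightarrow> 'm \<Rightarrow> 'm \<Rightarrow> real^'m \<Rightarrow> real" where
  "Bproj2 X i \<alpha> \<beta> u = partial \<alpha> (partial \<beta> (\<lambda>u'. X u' $ i)) u"

definition supp_elem :: "(real^'m::finite \<Rightarrow> real^'n::finite) \<Rightarrow> real^'m \<Rightarrow> real^'m \<Rightarrow> real^'n" where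
  "supp_elem X u v = (\<chi> i. \<Sum>\<alpha>\<in>UNIV. Bproj X i \<alpha> u * v $ \<alpha>)"

definition unit_normal ::
  "'n::finite xyfun \<Rightarrow> (real^'m::finite \<Rightarrow> real^'n) \<Rightarrow> real^'m \<Rightarrow> real^'m \<Rightarrow> real^'n \<Rightarrow> bool" where
  "unit_normal L X u v N \<longleftrightarrow>
     (\<forall>\<alpha>. (\<Sum>i\<in>UNIV. \<Sum>j\<in>UNIV. gmet L i j (X u) (supp_elem X u v) * Bproj X i \<alpha> u * N $ j) = 0) \<and>
     (\<Sum>i\<in>UNIV. \<Sum>j\<in>UNIV. gmet L i j (X u) (supp_elem X u v) * N $ i * N $ j) = 1"

text \<open>\<open>normal_curv L X u v N \<alpha>\<close> is \<open>H_\<alpha> = N_i (B^i_{0\<alpha>} + G^i_j B^j_\<alpha>)\<close>, where \<open>N_i = g_{ij} N^j\<close>.\<close>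

definition normal_curv ::
  "'n::finite xyfun \<Rightarrow> (real^'m::finite \<Rightarrow> real^'n) \<Rightarrow> real^'m \<Rightarrow> real^'m \<Rightarrow> real^'n \<Rightarrow> 'm \<Rightarrow> real" where
  "normal_curv L X u v N \<alpha> =
     (\<Sum>i\<in>UNIV. (\<Sum>j\<in>UNIV. gmet L i j (X u) (supp_elem X u v) * N $ j) *
        ((\<Sum>\<beta>\<in>UNIV. Bproj2 X i \<beta> \<alpha> u * v $ \<beta>) +
         (\<Sum>j\<in>UNIV. nonlin L i j (X u) (supp_elem X u v) * Bproj X j \<alpha> u)))"

text \<open>The map \<open>\<iota>\<close> from the \<open>(n-1)\<close>-dimensional manifold \<open>'q\<close> (atlas \<open>A'\<close>) to \<open>'p\<close> (atlas \<open>A\<close>), read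
  in the charts \<open>d \<in> A'\<close> and \<open>c \<in> A\<close>.\<close>

definition param :: "('q \<Rightarrow> 'p) \<Rightarrow> ('p, 'n::finite) chart \<Rightarrow> ('q, 'm::finite) chart \<Rightarrow> real^'m \<Rightarrow> real^'n" where
  "param \<iota> c d = snd c \<circ> \<iota> \<circ> chart_inv d"

definition param_domain :: "('q \<Rightarrow> 'p) \<Rightarrow> ('p, 'n::finite) chart \<Rightarrow> ('q, 'm::finite) chart \<Rightarrow> (real^'m) set" where
  "param_domain \<iota> c d = snd d ` (fst d \<inter> \<iota> -` fst c)"

definition hypersurface ::
  "('p::{t2_space,second_countable_topology}, 'n::finite) chart set
     \<Rightarrow> ('q::{t2_space,second_countable_topology}, 'm::finite) chart set \<Rightarrow> ('q \<Rightarrow> 'p) \<Rightarrow> bool" where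
  "hypersurface A A' \<iota> \<longleftrightarrow>
     CARD('n) = CARD('m) + 1 \<and> smooth_atlas A' \<and> continuous_on UNIV \<iota> \<and>
     (\<forall>c\<in>A. \<forall>d\<in>A'. smooth_on (param_domain \<iota> c d) (param \<iota> c d) \<and>
        (\<forall>u\<in>param_domain \<iota> c d.
           rank (\<chi> i \<alpha>. Bproj (param \<iota> c d) i \<alpha> u) = CARD('m)))"

definition tangent_to_hypersurface ::
  "('p, 'n::finite) chart set \<Rightarrow> ('q, 'm::finite) chart set \<Rightarrow> ('q \<Rightarrow> 'p)
     \<Rightarrow> (('p, 'n) chart \<Rightarrow> ((real^'n) \<times> (real^'n)) set) \<Rightarrow> (('p, 'n) chart \<Rightarrow> 'n xyfun)
     \<Rightarrow> (('p, 'n) chart \<Rightarrow> real^'n \<Rightarrow> real^'n \<Rightarrow> real^'n) \<Rightarrow> bool" where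
  "tangent_to_hypersurface A A' \<iota> D L b \<longleftrightarrow>
     (\<forall>c\<in>A. \<forall>d\<in>A'. \<forall>u\<in>param_domain \<iota> c d. \<forall>v N.
        (param \<iota> c d u, supp_elem (param \<iota> c d) u v) \<in> D c \<and>
        unit_normal (L c) (param \<iota> c d) u v N \<longrightarrow>
        (\<Sum>i\<in>UNIV. b c (param \<iota> c d u) (supp_elem (param \<iota> c d) u v) $ i * N $ i) = 0)"

text \<open>By strong convexity the unit normal at \<open>(u, v)\<close> exists and is unique up to sign, and
  \<open>H_\<alpha> = 0\<close> does not depend on the sign.\<close>

definition hyperplane_first_kind ::
  "('p, 'n::finite) chart set \<Rightarrow> ('q, 'm::finite) chart set \<Rightarrow> ('q \<Rightarrow> 'p)
     \<Rightarrow> (('p, 'n) chart \<Rightarrow> ((real^'n) \<times> (real^'n)) set) \<Rightarrow> (('p, 'n) chart \<Rightarrow> 'n xyfun) \<Rightarrow> bool" where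
  "hyperplane_first_kind A A' \<iota> D L \<longleftrightarrow>
     (\<forall>c\<in>A. \<forall>d\<in>A'. \<forall>u\<in>param_domain \<iota> c d. \<forall>v N.
        (param \<iota> c d u, supp_elem (param \<iota> c d) u v) \<in> D c \<and>
        unit_normal (L c) (param \<iota> c d) u v N \<longrightarrow>
        (\<forall>\<alpha>. normal_curv (L c) (param \<iota> c d) u v N \<alpha> = 0))"

end

theory Submission
  imports Defs
begin

text \<open>Fix a conormal \<open>\<nu>\<close> of the hypersurface. Since \<open>G\<^sup>i\<close> is homogeneous of degree two in \<open>y\<close>, the normal
  curvature vanishes for all tangent supporting elements iff \<open>\<nu>\<^sub>i (B\<^sup>i\<^sub>0\<^sub>0 + 2 G\<^sup>i)\<close> does, so it suffices
  that \<open>\<nu>\<^sub>i G\<^sup>i\<close> is the same for \<open>L\<close> and for the Kropina metric \<open>K = L\<^sup>2/\<beta>\<close>. Let \<open>E\<close> be the Euler-Lagrange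
  operator along the spray of \<open>L\<close>. Then \<open>E(L\<^sup>2) = 0\<close>, and the gradient condition says \<open>E(\<beta>) = 0\<close>. By the
  product rule \<open>E(K\<^sup>2)\<close> is a combination of the \<open>y\<close>-differentials of \<open>L\<close> and \<open>\<beta>\<close>, that is of \<open>y\<^sub>i\<close> and
  \<open>b\<^sub>i\<close>, which both annihilate the normal \<open>N\<close>. As \<open>E(K\<^sup>2)\<close> is also the lowered difference of the two
  sprays up to a factor, and \<open>K\<close>-lowering \<open>N\<close> gives a nonzero multiple of \<open>\<nu>\<close>, the sprays agree on
  \<open>\<nu>\<close> wherever \<open>\<beta> \<noteq> 0\<close>; by density this is enough.\<close>

section \<open>Calculus of smooth functions on open sets\<close>

lemma Ck_on_cong:
  assumes "open S" "\<And>z. z \<in> S \<Longrightarrow> f z = g z" "Ck_on k f S"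
  shows "Ck_on k g S"
  using assms(2,3)
proof (induction k arbitrary: f g)
  case 0
  then show ?case by (simp cong: continuous_on_cong)
next
  case (Suc k)
  have d: "g differentiable (at z)" if "z \<in> S" for z
    using that Suc.prems assms(1)
    by (meson Ck_on.simps(2) differentiable_def has_derivative_transform_within_open)
  have "frechet_derivative f (at z) = frechet_derivative g (at z)" if "z \<in> S" for z
    by (rule frechet_derivative_transform_within_open[OF _ assms(1)]) (use Suc.prems that in auto)
  then have "Ck_on k (\<lambda>z. frechet_derivative g (at z) v) S" for v
    using Suc.IH[of "\<lambda>z. frechet_derivative f (at z) v" "\<lambda>z. frechet_derivative g (at z) v"]
      Suc.prems by simp
  with d show ?case by simp
qed

lemma Ck_on_Suc_imp: "Ck_on (Suc k) f S \<Longrightarrow> Ck_on k f S"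
proof (induction k arbitrary: f)
  case 0
  then show ?case
    by (auto intro!: continuous_at_imp_continuous_on differentiable_imp_continuous_within)
next
  case (Suc k)
  then show ?case by (meson Ck_on.simps(2))
qed

lemma Ck_on_const: "Ck_on k (\<lambda>z. c) S"
  by (induction k arbitrary: c) auto

text \<open>The derivative at every point is \<open>h\<close> itself, so each directional derivative
  is constant.\<close>

lemma Ck_on_bounded_linear:
  assumes "bounded_linear h" shows "Ck_on k h S"
proof (cases k)
  case 0
  then show ?thesis using assms by (simp add: linear_continuous_on)
next
  case (Suc m)
  have "frechet_derivative h (at z) = h" for z
    using assms by (metis bounded_linear_imp_has_derivative frechet_derivative_at)
  then show ?thesis
    using assms by (auto simp: Suc Ck_on_const bounded_linear_imp_differentiable)
qed

lemma Ck_on_add: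
  assumes "open S" "Ck_on k f S" "Ck_on k g S"
  shows "Ck_on k (\<lambda>z. f z + g z) S"
  using assms(2,3)
proof (induction k arbitrary: f g)
  case 0
  then show ?case by (auto intro: continuous_intros)
next
  case (Suc k)
  have e: "frechet_derivative (\<lambda>z. f z + g z) (at z) v
      = frechet_derivative f (at z) v + frechet_derivative g (at z) v" if "z \<in> S" for z v
  proof -
    have "((\<lambda>z. f z + g z) has_derivative
        (\<lambda>v. frechet_derivative f (at z) v + frechet_derivative g (at z) v)) (at z)"
      using Suc.prems that by (auto intro!: derivative_intros simp: frechet_derivative_works[symmetric])
    then show ?thesis by (metis frechet_derivative_at)
  qed
  have "Ck_on k (\<lambda>z. frechet_derivative (\<lambda>z. f z + g z) (at z) v) S" for v
    by (rule Ck_on_cong[OF assms(1), where f = "\<lambda>z. frechet_derivative f (at z) v + frechet_derivative g (at z) v"])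
      (use Suc e in auto)
  then show ?case using Suc.prems by auto
qed

lemma Ck_on_mult:
  fixes f g :: "'a::real_normed_vector \<Rightarrow> real"
  assumes "open S" "Ck_on k f S" "Ck_on k g S"
  shows "Ck_on k (\<lambda>z. f z * g z) S"
  using assms(2,3)
proof (induction k arbitrary: f g)
  case 0
  then show ?case by (auto intro: continuous_intros)
next
  case (Suc k)
  have e: "frechet_derivative (\<lambda>z. f z * g z) (at z) v
      = f z * frechet_derivative g (at z) v + frechet_derivative f (at z) v * g z" if "z \<in> S" for z v
  proof -
    have "((\<lambda>z. f z * g z) has_derivative
        (\<lambda>v. f z * frechet_derivative g (at z) v + frechet_derivative f (at z) v * g z)) (at z)"
      using Suc.prems that by (auto intro!: derivative_intros simp: frechet_derivative_works[symmetric])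
    then show ?thesis by (metis frechet_derivative_at)
  qed
  \<comment> \<open>The product rule keeps one factor undifferentiated; the induction hypothesis
    wants it with order \<open>k\<close>.\<close>
  have l: "Ck_on k f S" "Ck_on k g S"
    using Suc.prems by (auto intro: Ck_on_Suc_imp)
  have "Ck_on k (\<lambda>z. f z * frechet_derivative g (at z) v + frechet_derivative f (at z) v * g z) S" for v
    using Suc.prems l by (intro Ck_on_add[OF assms(1)] Suc.IH) simp_all
  then have "Ck_on k (\<lambda>z. frechet_derivative (\<lambda>z. f z * g z) (at z) v) S" for v
    by (rule Ck_on_cong[OF assms(1), rotated]) (simp add: e)
  then show ?case using Suc.prems by auto
qed

lemma Ck_on_bounded_linear_compose:
  assumes "open S" "bounded_linear h" "Ck_on k f S"
  shows "Ck_on k (\<lambda>z. h (f z)) S"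
  using assms(3)
proof (induction k arbitrary: f)
  case 0
  then show ?case using assms(2) by (simp add: bounded_linear.continuous_on)
next
  case (Suc k)
  have e: "((\<lambda>z. h (f z)) has_derivative (\<lambda>v. h (frechet_derivative f (at z) v))) (at z)"
    if "z \<in> S" for z
    using Suc.prems that by (auto intro!: bounded_linear.has_derivative[OF assms(2)]
        simp: frechet_derivative_works[symmetric])
  have "Ck_on k (\<lambda>z. frechet_derivative (\<lambda>z. h (f z)) (at z) v) S" for v
    by (rule Ck_on_cong[OF assms(1), where f = "\<lambda>z. h (frechet_derivative f (at z) v)"])
      (use Suc frechet_derivative_at[OF e] in \<open>auto simp: fun_eq_iff\<close>)
  then show ?case using e by (auto simp: differentiable_def)
qed

lemma smooth_on_imp_differentiable: "smooth_on S f \<Longrightarrow> z \<in> S \<Longrightarrow> f differentiable (at z)"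
  unfolding smooth_on_def using Ck_on.simps(2) by blast

lemma smooth_on_imp_has_derivative:
  "smooth_on S f \<Longrightarrow> z \<in> S \<Longrightarrow> (f has_derivative frechet_derivative f (at z)) (at z)"
  using smooth_on_imp_differentiable frechet_derivative_works by blast

lemma smooth_on_frechet_derivative: "smooth_on S f \<Longrightarrow> smooth_on S (\<lambda>z. frechet_derivative f (at z) v)"
  unfolding smooth_on_def using Ck_on.simps(2) by blast

lemma smooth_on_cong:
  "open S \<Longrightarrow> (\<And>z. z \<in> S \<Longrightarrow> f z = g z) \<Longrightarrow> smooth_on S f \<Longrightarrow> smooth_on S g"
  unfolding smooth_on_def using Ck_on_cong by blast

lemma smooth_on_const: "smooth_on S (\<lambda>z. c)"
  by (simp add: smooth_on_def Ck_on_const)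

lemma smooth_on_add:
  "open S \<Longrightarrow> smooth_on S f \<Longrightarrow> smooth_on S g \<Longrightarrow> smooth_on S (\<lambda>z. f z + g z)"
  by (simp add: smooth_on_def Ck_on_add)

lemma smooth_on_mult:
  fixes f g :: "'a::real_normed_vector \<Rightarrow> real"
  shows "open S \<Longrightarrow> smooth_on S f \<Longrightarrow> smooth_on S g \<Longrightarrow> smooth_on S (\<lambda>z. f z * g z)"
  by (simp add: smooth_on_def Ck_on_mult)

lemma smooth_on_sum:
  "open S \<Longrightarrow> (\<And>i. i \<in> I \<Longrightarrow> smooth_on S (f i)) \<Longrightarrow> smooth_on S (\<lambda>z. \<Sum>i\<in>I. f i z)"
  by (induction I rule: infinite_finite_induct) (auto intro: smooth_on_add smooth_on_const)

lemma smooth_on_bounded_linear: "bounded_linear h \<Longrightarrow> smooth_on S h"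
  by (simp add: smooth_on_def Ck_on_bounded_linear)

lemma smooth_on_bounded_linear_compose:
  "open S \<Longrightarrow> bounded_linear h \<Longrightarrow> smooth_on S f \<Longrightarrow> smooth_on S (\<lambda>z. h (f z))"
  by (simp add: smooth_on_def Ck_on_bounded_linear_compose)

lemma smooth_on_subset:
  assumes "smooth_on S f" "T \<subseteq> S" shows "smooth_on T f"
proof -
  have "Ck_on k f S \<Longrightarrow> Ck_on k f T" for k
    by (induction k arbitrary: f) (use assms(2) continuous_on_subset in auto)
  with assms(1) show ?thesis by (simp add: smooth_on_def)
qed

lemma smooth_on_imp_continuous_on: "smooth_on S f \<Longrightarrow> continuous_on S f"
  unfolding smooth_on_def using Ck_on.simps(1) by blast

text \<open>The second difference of \<open>f\<close> along \<open>v\<close> and \<open>w\<close> is \<open>h\<^sup>2\<close> times a mixed derivative at a nearby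
  point; as it is symmetric in \<open>v\<close> and \<open>w\<close>, so is the mixed derivative in the limit.\<close>

lemma second_difference_mean_value:
  fixes f :: "'a::real_normed_vector \<Rightarrow> real"
  assumes sm: "smooth_on S f" and h: "h > 0"
    and S: "cball z (h * (norm v + norm w)) \<subseteq> S"
  obtains p where "norm (p - z) \<le> h * (norm v + norm w)"
    "f (z + h *\<^sub>R v + h *\<^sub>R w) - f (z + h *\<^sub>R v) - f (z + h *\<^sub>R w) + f z
      = h^2 * frechet_derivative (\<lambda>q. frechet_derivative f (at q) v) (at p) w"
proof -
  have bd: "norm (s *\<^sub>R v + t *\<^sub>R w) \<le> h * (norm v + norm w)"
    if "0 \<le> s" "s \<le> h" "0 \<le> t" "t \<le> h" for s t
  proof -
    have "norm (s *\<^sub>R v + t *\<^sub>R w) \<le> s * norm v + t * norm w"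
      using norm_triangle_ineq[of "s *\<^sub>R v" "t *\<^sub>R w"] that by simp
    also have "\<dots> \<le> h * norm v + h * norm w"
      using that by (intro add_mono mult_right_mono) auto
    finally show ?thesis by (simp add: algebra_simps)
  qed
  have inS: "z + s *\<^sub>R v + t *\<^sub>R w \<in> S" if "0 \<le> s" "s \<le> h" "0 \<le> t" "t \<le> h" for s t
    using bd[OF that] S by (auto simp: dist_norm norm_minus_commute subset_iff add.assoc)
  let ?D = "\<lambda>q. frechet_derivative f (at q)"
  \<comment> \<open>\<open>?q h - ?q 0\<close> is the second difference. The mean value theorem is
    applied to \<open>?q\<close>, and then, in direction \<open>w\<close>, to the derivative of
    \<open>f\<close> along \<open>v\<close>.\<close>
  let ?q = "\<lambda>s. f (z + s *\<^sub>R v + h *\<^sub>R w) - f (z + s *\<^sub>R v)"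
  have dq: "(?q has_derivative (\<lambda>r. r * (?D (z + s *\<^sub>R v + h *\<^sub>R w) v - ?D (z + s *\<^sub>R v) v))) (at s)"
    if "0 \<le> s" "s \<le> h" for s
  proof -
    have 1: "z + s *\<^sub>R v + h *\<^sub>R w \<in> S" "z + s *\<^sub>R v \<in> S"
      using inS[of s h] inS[of s 0] that h by auto
    note d = smooth_on_imp_has_derivative[OF sm 1(1)] smooth_on_imp_has_derivative[OF sm 1(2)]
    have l: "?D (z + s *\<^sub>R v + h *\<^sub>R w) (r *\<^sub>R v) = r * ?D (z + s *\<^sub>R v + h *\<^sub>R w) v"
      "?D (z + s *\<^sub>R v) (r *\<^sub>R v) = r * ?D (z + s *\<^sub>R v) v" for r
      by (simp_all add: linear_scale[OF has_derivative_linear[OF d(1)]]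
          linear_scale[OF has_derivative_linear[OF d(2)]])
    have "((\<lambda>s. f (z + s *\<^sub>R v + h *\<^sub>R w)) has_derivative
        (\<lambda>r. ?D (z + s *\<^sub>R v + h *\<^sub>R w) (r *\<^sub>R v))) (at s)"
      by (rule has_derivative_compose[where g = f and f = "\<lambda>s. z + s *\<^sub>R v + h *\<^sub>R w", OF _ d(1)])
        (auto intro!: derivative_eq_intros)
    moreover have "((\<lambda>s. f (z + s *\<^sub>R v)) has_derivative (\<lambda>r. ?D (z + s *\<^sub>R v) (r *\<^sub>R v))) (at s)"
      by (rule has_derivative_compose[where g = f and f = "\<lambda>s. z + s *\<^sub>R v", OF _ d(2)])
        (auto intro!: derivative_eq_intros)
    ultimately have "(?q has_derivative
        (\<lambda>r. ?D (z + s *\<^sub>R v + h *\<^sub>R w) (r *\<^sub>R v) - ?D (z + s *\<^sub>R v) (r *\<^sub>R v))) (at s)"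
      by (rule has_derivative_diff)
    then show ?thesis by (simp add: l right_diff_distrib)
  qed
  obtain \<xi> where \<xi>: "0 < \<xi>" "\<xi> < h"
    "?q h - ?q 0 = h * (?D (z + \<xi> *\<^sub>R v + h *\<^sub>R w) v - ?D (z + \<xi> *\<^sub>R v) v)"
    using mvt_simple[OF h has_derivative_at_withinI[OF dq]] by (auto simp: algebra_simps)
  let ?g = "\<lambda>q. ?D q v"
  have dr: "((\<lambda>t. ?g (z + \<xi> *\<^sub>R v + t *\<^sub>R w)) has_derivative
      (\<lambda>r. r * frechet_derivative ?g (at (z + \<xi> *\<^sub>R v + t *\<^sub>R w)) w)) (at t)"
    if "0 \<le> t" "t \<le> h" for t
  proof -
    have "z + \<xi> *\<^sub>R v + t *\<^sub>R w \<in> S" using inS that \<xi> by auto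
    note d = smooth_on_imp_has_derivative[OF smooth_on_frechet_derivative[OF sm] this]
    have "((\<lambda>t. ?g (z + \<xi> *\<^sub>R v + t *\<^sub>R w)) has_derivative
      (\<lambda>r. frechet_derivative ?g (at (z + \<xi> *\<^sub>R v + t *\<^sub>R w)) (r *\<^sub>R w))) (at t)"
      by (rule has_derivative_compose[where g = ?g and f = "\<lambda>t. z + \<xi> *\<^sub>R v + t *\<^sub>R w", OF _ d])
        (auto intro!: derivative_eq_intros)
    moreover have "frechet_derivative ?g (at (z + \<xi> *\<^sub>R v + t *\<^sub>R w)) (r *\<^sub>R w)
        = r * frechet_derivative ?g (at (z + \<xi> *\<^sub>R v + t *\<^sub>R w)) w" for r
      by (simp add: linear_scale[OF has_derivative_linear[OF d]])
    ultimately show ?thesis by simp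
  qed
  obtain \<eta> where \<eta>: "0 < \<eta>" "\<eta> < h"
    "?g (z + \<xi> *\<^sub>R v + h *\<^sub>R w) - ?g (z + \<xi> *\<^sub>R v)
      = h * frechet_derivative ?g (at (z + \<xi> *\<^sub>R v + \<eta> *\<^sub>R w)) w"
    using mvt_simple[OF h has_derivative_at_withinI[OF dr]] by auto
  show thesis
  proof
    show "norm (z + \<xi> *\<^sub>R v + \<eta> *\<^sub>R w - z) \<le> h * (norm v + norm w)"
      using bd[of \<xi> \<eta>] \<xi> \<eta> by (simp add: add.assoc)
    show "f (z + h *\<^sub>R v + h *\<^sub>R w) - f (z + h *\<^sub>R v) - f (z + h *\<^sub>R w) + f z
      = h^2 * frechet_derivative (\<lambda>q. frechet_derivative f (at q) v) (at (z + \<xi> *\<^sub>R v + \<eta> *\<^sub>R w)) w"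
      using \<xi>(3) unfolding \<eta>(3) by (simp add: power2_eq_square)
  qed
qed

lemma frechet_derivative_commute:
  fixes f :: "'a::real_normed_vector \<Rightarrow> real"
  assumes S: "open S" and sm: "smooth_on S f" and z: "z \<in> S"
  shows "frechet_derivative (\<lambda>q. frechet_derivative f (at q) v) (at z) w
    = frechet_derivative (\<lambda>q. frechet_derivative f (at q) w) (at z) v"
proof -
  define F where "F v w q = frechet_derivative (\<lambda>q. frechet_derivative f (at q) v) (at q) w" for v w q
  have c: "isCont (F v w) z" for v w
  proof -
    have "smooth_on S (F v w)"
      unfolding F_def by (intro smooth_on_frechet_derivative sm)
    then show ?thesis
      using S z smooth_on_imp_continuous_on continuous_on_eq_continuous_at by blast
  qed
  have "\<bar>F v w z - F w v z\<bar> \<le> e" if e: "e > 0" for e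
  proof -
    have 1: "\<exists>d>0. \<forall>q. dist q z < d \<longrightarrow> dist (F v w q) (F v w z) < e/2" for v w
      using c[of v w] e unfolding continuous_at_eps_delta by (metis half_gt_zero)
    obtain d1 where d1: "d1 > 0" "\<And>q. dist q z < d1 \<Longrightarrow> dist (F v w q) (F v w z) < e/2"
      using 1 by meson
    obtain d2 where d2: "d2 > 0" "\<And>q. dist q z < d2 \<Longrightarrow> dist (F w v q) (F w v z) < e/2"
      using 1 by meson
    obtain d3 where d3: "d3 > 0" "cball z d3 \<subseteq> S"
      using S z open_contains_cball by metis
    define d where "d = min d3 (min d1 d2 / 2)"
    \<comment> \<open>The summand 1 keeps the denominator positive when \<open>v\<close> and
      \<open>w\<close> are both zero.\<close>
    define h where "h = d / (norm v + norm w + 1)"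
    have d: "d > 0" "d < d1" "d < d2" "d \<le> d3" using d1 d2 d3 by (auto simp: d_def)
    have h: "h > 0" using d by (auto simp: h_def intro!: divide_pos_pos add_nonneg_pos)
    have hd: "h * (norm v + norm w) \<le> d"
    proof -
      have "h * (norm v + norm w) \<le> h * (norm v + norm w + 1)" using h by simp
      also have "\<dots> = d"
        using add_nonneg_pos[of "norm v + norm w" 1] by (simp add: h_def)
      finally show ?thesis .
    qed
    then have cb: "cball z (h * (norm v + norm w)) \<subseteq> S" "cball z (h * (norm w + norm v)) \<subseteq> S"
      using d d3 by (auto simp: add.commute)
    obtain p where p: "norm (p - z) \<le> h * (norm v + norm w)"
      "f (z + h *\<^sub>R v + h *\<^sub>R w) - f (z + h *\<^sub>R v) - f (z + h *\<^sub>R w) + f z = h^2 * F v w p"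
      using second_difference_mean_value[OF sm h cb(1)] unfolding F_def by blast
    obtain q where q: "norm (q - z) \<le> h * (norm w + norm v)"
      "f (z + h *\<^sub>R w + h *\<^sub>R v) - f (z + h *\<^sub>R w) - f (z + h *\<^sub>R v) + f z = h^2 * F w v q"
      using second_difference_mean_value[OF sm h cb(2)] unfolding F_def by blast
    have "h^2 * F v w p = h^2 * F w v q"
      unfolding p(2)[symmetric] q(2)[symmetric] by (simp add: algebra_simps)
    then have "F v w p = F w v q" using h by simp
    moreover have "dist p z < d1" "dist q z < d2"
      using p(1) q(1) hd d by (auto simp: dist_norm add.commute)
    then have "dist (F v w p) (F v w z) < e/2" "dist (F w v q) (F w v z) < e/2"
      using d1(2) d2(2) by blast+
    ultimately show ?thesis by (simp add: dist_real_def abs_real_def split: if_splits)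
  qed
  then have "\<bar>F v w z - F w v z\<bar> \<le> 0" by (rule dense_ge)
  then have "F v w z = F w v z" by simp
  then show ?thesis by (simp add: F_def)
qed

text \<open>No differentiability is assumed: both functions have the same derivatives at
  \<open>x\<close>, if any, and \<open>frechet_derivative\<close> is a choice among these, so even
  its arbitrary values agree.\<close>

lemma frechet_derivative_cong:
  assumes "open S" "x \<in> S" "\<And>z. z \<in> S \<Longrightarrow> f z = g z"
  shows "frechet_derivative f (at x) = frechet_derivative g (at x)"
proof -
  have "(f has_derivative f') (at x) \<longleftrightarrow> (g has_derivative f') (at x)" for f'
    using assms by (metis has_derivative_transform_within_open)
  then show ?thesis by (simp add: frechet_derivative_def)
qed

section \<open>Partial derivatives and homogeneous functions of one vector variable\<close>

lemma partial_cong: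
  "open S \<Longrightarrow> x \<in> S \<Longrightarrow> (\<And>z. z \<in> S \<Longrightarrow> f z = g z) \<Longrightarrow> partial i f x = partial i g x"
  unfolding partial_def using frechet_derivative_cong by metis

lemma partial_eqI: "(f has_derivative f') (at x) \<Longrightarrow> partial i f x = f' (axis i 1)"
  unfolding partial_def by (metis frechet_derivative_at)

lemma has_derivative_partial:
  assumes "f differentiable (at x)"
  shows "(f has_derivative (\<lambda>h. \<Sum>i\<in>UNIV. h $ i * partial i f x)) (at x)"
proof -
  let ?D = "frechet_derivative f (at x)"
  have d: "(f has_derivative ?D) (at x)" using assms frechet_derivative_works by blast
  note l = has_derivative_linear[OF d]
  have "?D h = (\<Sum>i\<in>UNIV. h $ i * partial i f x)" for h
  proof -
    have "?D h = ?D (\<Sum>i\<in>UNIV. h $ i *\<^sub>R axis i 1)"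
      by (simp add: basis_expansion scalar_mult_eq_scaleR[symmetric])
    also have "\<dots> = (\<Sum>i\<in>UNIV. h $ i * partial i f x)"
      by (simp add: linear_sum[OF l] linear_scale[OF l] partial_def)
    finally show ?thesis .
  qed
  with d show ?thesis by (metis (no_types, lifting) ext)
qed

text \<open>Differentiate \<open>f (t *\<^sub>R y)\<close> at \<open>t = 1\<close> in two ways: by
  the chain rule, and as \<open>t ^ k * f y\<close>.\<close>

lemma euler_homogeneous:
  assumes f: "f differentiable (at y)" and hom: "\<And>t::real. t > 0 \<Longrightarrow> f (t *\<^sub>R y) = t ^ k * f y"
  shows "(\<Sum>i\<in>UNIV. y $ i * partial i f y) = real k * f y"
proof -
  have "((\<lambda>t. f (t *\<^sub>R y)) has_derivative (\<lambda>r. \<Sum>i\<in>UNIV. (r *\<^sub>R y) $ i * partial i f y)) (at 1)"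
    by (rule has_derivative_compose[where g = f and f = "\<lambda>t. t *\<^sub>R y"])
      (use has_derivative_partial[OF f] in \<open>auto intro!: derivative_eq_intros\<close>)
  moreover have "((\<lambda>t. f (t *\<^sub>R y)) has_derivative (\<lambda>r. r * (real k * f y))) (at 1)"
    by (rule has_derivative_transform_within_open[OF _ open_greaterThan[of 0], where f = "\<lambda>t. t ^ k * f y"])
      (auto intro!: derivative_eq_intros simp: hom)
  ultimately have "(\<lambda>r. \<Sum>i\<in>UNIV. (r *\<^sub>R y) $ i * partial i f y) = (\<lambda>r. r * (real k * f y))"
    by (rule has_derivative_unique)
  from fun_cong[OF this, of 1] show ?thesis by simp
qed

text \<open>The chain rule for scaling by \<open>t\<close> produces one factor \<open>t\<close>;
  cancelling it lowers the degree by one.\<close>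

lemma partial_scale:
  assumes S: "open S" "y \<in> S" and t: "t > 0" and f: "f differentiable (at (t *\<^sub>R y))"
    and g: "g differentiable (at y)"
    and hom: "\<And>z. z \<in> S \<Longrightarrow> f (t *\<^sub>R z) = t ^ Suc k * g z"
  shows "partial i f (t *\<^sub>R y) = t ^ k * partial i g y"
proof -
  have d: "(f has_derivative frechet_derivative f (at (t *\<^sub>R y))) (at (t *\<^sub>R y))"
    "(g has_derivative frechet_derivative g (at y)) (at y)"
    using f g frechet_derivative_works by blast+
  have "((\<lambda>z. f (t *\<^sub>R z)) has_derivative (\<lambda>h. frechet_derivative f (at (t *\<^sub>R y)) (t *\<^sub>R h))) (at y)"
    by (rule has_derivative_compose[where g = f and f = "\<lambda>z. t *\<^sub>R z", OF _ d(1)])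
      (auto intro!: derivative_eq_intros)
  moreover have "((\<lambda>z. f (t *\<^sub>R z)) has_derivative (\<lambda>h. t ^ Suc k * frechet_derivative g (at y) h)) (at y)"
    by (rule has_derivative_transform_within_open[OF _ S, where f = "\<lambda>z. t ^ Suc k * g z"])
      (use hom d(2) in \<open>auto intro!: derivative_eq_intros\<close>)
  ultimately have "frechet_derivative f (at (t *\<^sub>R y)) (t *\<^sub>R axis i 1)
      = t ^ Suc k * frechet_derivative g (at y) (axis i 1)"
    using has_derivative_unique by (metis (no_types, lifting))
  then have "t * partial i f (t *\<^sub>R y) = t * (t ^ k * partial i g y)"
    by (simp add: partial_def linear_scale[OF has_derivative_linear[OF d(1)]])
  then show ?thesis using t by simp
qed

section \<open>Differentiability of the inverse matrix\<close>

lemma differentiable_prod: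
  fixes f :: "'i \<Rightarrow> 'a::real_normed_vector \<Rightarrow> real"
  shows "(\<And>i. i \<in> I \<Longrightarrow> f i differentiable (at z)) \<Longrightarrow> (\<lambda>x. \<Prod>i\<in>I. f i x) differentiable (at z)"
  by (induction I rule: infinite_finite_induct) auto

lemma differentiable_det:
  fixes M :: "'a::real_normed_vector \<Rightarrow> real^'n^'n"
  assumes "\<And>i j. (\<lambda>x. M x $ i $ j) differentiable (at z)"
  shows "(\<lambda>x. det (M x)) differentiable (at z)"
  unfolding det_def
  by (intro differentiable_sum ballI differentiable_mult differentiable_const differentiable_prod assms) simp

text \<open>Cramer's rule with column \<open>j\<close> of the identity as right-hand side. As a
  quotient of determinants the entry depends differentiably on the matrix.\<close>

lemma matrix_inv_component:
  fixes M :: "real^'n^'n"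
  assumes "invertible M"
  shows "matrix_inv M $ i $ j = det (\<chi> k l. if l = i then axis j 1 $ k else M $ k $ l) / det M"
proof -
  have "M ** matrix_inv M = mat 1"
    using assms unfolding invertible_def matrix_inv_def by (rule someI_ex[THEN conjunct1])
  then have "M *v (matrix_inv M *v axis j 1) = axis j 1"
    by (simp add: matrix_vector_mul_assoc)
  then have "matrix_inv M *v axis j 1
      = (\<chi> k. det (\<chi> k' l. if l = k then axis j 1 $ k' else M $ k' $ l) / det M)"
    using assms cramer invertible_det_nz by blast
  moreover have "(matrix_inv M *v axis j 1) $ i = matrix_inv M $ i $ j"
    by (simp add: matrix_vector_mul_component inner_axis)
  ultimately show ?thesis by simp
qed

lemma differentiable_matrix_inv:
  fixes M :: "'a::real_normed_vector \<Rightarrow> real^'n^'n"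
  assumes "\<And>i j. (\<lambda>x. M x $ i $ j) differentiable (at z)"
    and S: "open S" "z \<in> S" and inv: "\<And>x. x \<in> S \<Longrightarrow> invertible (M x)"
  shows "(\<lambda>x. matrix_inv (M x) $ i $ j) differentiable (at z)"
proof -
  let ?C = "\<lambda>x. \<chi> k l. if l = i then axis j 1 $ k else M x $ k $ l"
  have "(\<lambda>x. ?C x $ k $ l) differentiable (at z)" for k l
    by (cases "l = i") (auto simp: assms(1))
  then have "(\<lambda>x. det (?C x) / det (M x)) differentiable (at z)"
    using inv[OF S(2)] by (intro differentiable_divide differentiable_det assms(1)) (auto simp: invertible_det_nz)
  then obtain D where "((\<lambda>x. det (?C x) / det (M x)) has_derivative D) (at z)"
    by (auto simp: differentiable_def)
  then have "((\<lambda>x. matrix_inv (M x) $ i $ j) has_derivative D) (at z)"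
    by (rule has_derivative_transform_within_open[OF _ S]) (simp add: matrix_inv_component[OF inv])
  then show ?thesis by (rule differentiableI)
qed

section \<open>Calculus of functions of a point and a supporting element\<close>

abbreviation smooth_xy :: "((real^'n) \<times> (real^'n)) set \<Rightarrow> 'n::finite xyfun \<Rightarrow> bool" where
  "smooth_xy S f \<equiv> smooth_on S (\<lambda>(x, y). f x y)"

lemma has_derivative_fix_snd:
  assumes "smooth_xy S f" "(x, y) \<in> S"
  shows "((\<lambda>x'. f x' y) has_derivative
    (\<lambda>h. frechet_derivative (\<lambda>(x, y). f x y) (at (x, y)) (h, 0))) (at x)"
proof -
  have "((\<lambda>x'. case (x', y) of (x, y) \<Rightarrow> f x y) has_derivative
    (\<lambda>h. frechet_derivative (\<lambda>(x, y). f x y) (at (x, y)) (h, 0))) (at x)"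
    by (rule has_derivative_compose[where f = "\<lambda>x'. (x', y)", OF _ smooth_on_imp_has_derivative[OF assms]])
      (auto intro!: derivative_eq_intros)
  then show ?thesis by simp
qed

lemma has_derivative_fix_fst:
  assumes "smooth_xy S f" "(x, y) \<in> S"
  shows "((\<lambda>y'. f x y') has_derivative
    (\<lambda>h. frechet_derivative (\<lambda>(x, y). f x y) (at (x, y)) (0, h))) (at y)"
proof -
  have "((\<lambda>y'. case (x, y') of (x, y) \<Rightarrow> f x y) has_derivative
    (\<lambda>h. frechet_derivative (\<lambda>(x, y). f x y) (at (x, y)) (0, h))) (at y)"
    by (rule has_derivative_compose[where f = "\<lambda>y'. (x, y')", OF _ smooth_on_imp_has_derivative[OF assms]])
      (auto intro!: derivative_eq_intros)
  then show ?thesis by simp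
qed

text \<open>Partial derivatives become directional derivatives on the product space, from which
  smoothness and the symmetry of mixed derivatives are inherited.\<close>

lemma dx_eq_frechet:
  "smooth_xy S f \<Longrightarrow> (x, y) \<in> S \<Longrightarrow>
    dx i f x y = frechet_derivative (\<lambda>(x, y). f x y) (at (x, y)) (axis i 1, 0)"
  unfolding dx_def by (rule partial_eqI[OF has_derivative_fix_snd])

lemma dy_eq_frechet:
  "smooth_xy S f \<Longrightarrow> (x, y) \<in> S \<Longrightarrow>
    dy i f x y = frechet_derivative (\<lambda>(x, y). f x y) (at (x, y)) (0, axis i 1)"
  unfolding dy_def by (rule partial_eqI[OF has_derivative_fix_fst])

lemma smooth_xy_differentiable_snd: "smooth_xy S f \<Longrightarrow> (x, y) \<in> S \<Longrightarrow> f x differentiable (at y)"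
  using has_derivative_fix_fst differentiableI by blast

lemma smooth_xy_differentiable_fst:
  "smooth_xy S f \<Longrightarrow> (x, y) \<in> S \<Longrightarrow> (\<lambda>x. f x y) differentiable (at x)"
  using has_derivative_fix_snd differentiableI by blast

lemma smooth_xy_dx: "open S \<Longrightarrow> smooth_xy S f \<Longrightarrow> smooth_xy S (dx i f)"
  by (rule smooth_on_cong[OF _ _ smooth_on_frechet_derivative]) (auto simp: dx_eq_frechet)

lemma smooth_xy_dy: "open S \<Longrightarrow> smooth_xy S f \<Longrightarrow> smooth_xy S (dy i f)"
  by (rule smooth_on_cong[OF _ _ smooth_on_frechet_derivative]) (auto simp: dy_eq_frechet)

lemma smooth_xy_mult:
  "open S \<Longrightarrow> smooth_xy S f \<Longrightarrow> smooth_xy S g \<Longrightarrow> smooth_xy S (\<lambda>x y. f x y * g x y)"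
  using smooth_on_mult[of S "\<lambda>(x, y). f x y" "\<lambda>(x, y). g x y"] by (simp add: case_prod_unfold)

lemma smooth_xy_sum:
  "open S \<Longrightarrow> (\<And>i. i \<in> I \<Longrightarrow> smooth_xy S (f i)) \<Longrightarrow> smooth_xy S (\<lambda>x y. \<Sum>i\<in>I. f i x y)"
  using smooth_on_sum[of S I "\<lambda>i (x, y). f i x y"] by (simp add: case_prod_unfold)

lemma smooth_xy_component_snd: "smooth_xy S (\<lambda>x y. y $ i)"
  unfolding case_prod_unfold
  by (intro smooth_on_bounded_linear bounded_linear_compose[OF bounded_linear_vec_nth bounded_linear_snd])

lemma smooth_xy_component:
  assumes "open S" "smooth_on S (\<lambda>(x, y). X x y)"
  shows "smooth_xy S (\<lambda>x y. X x y $ i)"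
  using smooth_on_bounded_linear_compose[OF assms(1) bounded_linear_vec_nth assms(2)]
  by (simp add: case_prod_unfold)

text \<open>\<open>dx\<close> and \<open>dy\<close> freeze one argument, so locality arguments for
  them take place in the slices of \<open>S\<close>.\<close>

lemma open_slices:
  assumes "open (S :: ('a::topological_space \<times> 'b::topological_space) set)"
  shows "open {x. (x, y) \<in> S}" "open {y. (x, y) \<in> S}"
proof -
  have "open ((\<lambda>x. (x, y)) -` S)" "open (Pair x -` S)"
    by (intro open_vimage assms continuous_on_Pair continuous_on_const continuous_on_id)+
  then show "open {x. (x, y) \<in> S}" "open {y. (x, y) \<in> S}" by (simp_all add: vimage_def)
qed

lemma dx_cong:
  assumes "open S" "(x, y) \<in> S" "\<And>x y. (x, y) \<in> S \<Longrightarrow> f x y = g x y"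
  shows "dx i f x y = dx i g x y"
  unfolding dx_def by (rule partial_cong[OF open_slices(1)[OF assms(1)]]) (use assms in auto)

lemma dy_cong:
  assumes "open S" "(x, y) \<in> S" "\<And>x y. (x, y) \<in> S \<Longrightarrow> f x y = g x y"
  shows "dy i f x y = dy i g x y"
  unfolding dy_def by (rule partial_cong[OF open_slices(2)[OF assms(1)]]) (use assms in auto)

lemma dx_mult:
  assumes "smooth_xy S f" "smooth_xy S g" "(x, y) \<in> S"
  shows "dx i (\<lambda>x y. f x y * g x y) x y = f x y * dx i g x y + dx i f x y * g x y"
  unfolding dx_def
  by (rule trans[OF partial_eqI[OF has_derivative_mult]])
    (use assms smooth_xy_differentiable_fst in \<open>auto simp: frechet_derivative_works[symmetric] partial_def\<close>)

lemma dy_mult: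
  assumes "smooth_xy S f" "smooth_xy S g" "(x, y) \<in> S"
  shows "dy i (\<lambda>x y. f x y * g x y) x y = f x y * dy i g x y + dy i f x y * g x y"
  unfolding dy_def
  by (rule trans[OF partial_eqI[OF has_derivative_mult]])
    (use assms smooth_xy_differentiable_snd in \<open>auto simp: frechet_derivative_works[symmetric] partial_def\<close>)

lemma dy_add:
  assumes "smooth_xy S f" "smooth_xy S g" "(x, y) \<in> S"
  shows "dy i (\<lambda>x y. f x y + g x y) x y = dy i f x y + dy i g x y"
  unfolding dy_def
  by (rule trans[OF partial_eqI[OF has_derivative_add]])
    (use assms smooth_xy_differentiable_snd in \<open>auto simp: frechet_derivative_works[symmetric] partial_def\<close>)

lemma dx_sum:
  assumes "\<And>k. k \<in> I \<Longrightarrow> smooth_xy S (f k)" "(x, y) \<in> S"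
  shows "dx i (\<lambda>x y. \<Sum>k\<in>I. f k x y) x y = (\<Sum>k\<in>I. dx i (f k) x y)"
  unfolding dx_def
  by (rule trans[OF partial_eqI[OF has_derivative_sum[where f' = "\<lambda>k. frechet_derivative (\<lambda>x. f k x y) (at x)"]]])
    (simp_all add: frechet_derivative_works[symmetric] smooth_xy_differentiable_fst[OF assms] partial_def)

lemma dy_sum:
  assumes "\<And>k. k \<in> I \<Longrightarrow> smooth_xy S (f k)" "(x, y) \<in> S"
  shows "dy i (\<lambda>x y. \<Sum>k\<in>I. f k x y) x y = (\<Sum>k\<in>I. dy i (f k) x y)"
  unfolding dy_def
  by (rule trans[OF partial_eqI[OF has_derivative_sum[where f' = "\<lambda>k. frechet_derivative (f k x) (at y)"]]])
    (simp_all add: frechet_derivative_works[symmetric] smooth_xy_differentiable_snd[OF assms] partial_def)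

lemma dx_component_snd: "dx i (\<lambda>x y. y $ j) x y = 0"
  unfolding dx_def by (simp add: partial_def)

lemma dy_component_snd: "dy i (\<lambda>x y. y $ j) x y = (if i = j then 1 else 0)"
  unfolding dy_def by (rule trans[OF partial_eqI[OF bounded_linear_imp_has_derivative[OF bounded_linear_vec_nth]]])
    (simp add: axis_def)

lemma dy_commute:
  assumes "open S" "smooth_xy S f" "(x, y) \<in> S"
  shows "dy i (dy j f) x y = dy j (dy i f) x y"
proof -
  have "dy i (dy j f) x y = frechet_derivative (\<lambda>q. frechet_derivative (\<lambda>(x, y). f x y) (at q) (0, axis j 1))
      (at (x, y)) (0, axis i 1)" for i j
    unfolding dy_eq_frechet[OF smooth_xy_dy[OF assms(1,2)] assms(3)]
    by (subst frechet_derivative_cong[OF assms(1,3)]) (auto simp: dy_eq_frechet[OF assms(2)])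
  then show ?thesis using frechet_derivative_commute[OF assms] by simp
qed

lemma dy_dx_commute:
  assumes "open S" "smooth_xy S f" "(x, y) \<in> S"
  shows "dy i (dx j f) x y = dx j (dy i f) x y"
proof -
  have "dy i (dx j f) x y = frechet_derivative (\<lambda>q. frechet_derivative (\<lambda>(x, y). f x y) (at q) (axis j 1, 0))
      (at (x, y)) (0, axis i 1)"
    unfolding dy_eq_frechet[OF smooth_xy_dx[OF assms(1,2)] assms(3)]
    by (subst frechet_derivative_cong[OF assms(1,3)]) (auto simp: dx_eq_frechet[OF assms(2)])
  moreover have "dx j (dy i f) x y = frechet_derivative (\<lambda>q. frechet_derivative (\<lambda>(x, y). f x y) (at q) (0, axis i 1))
      (at (x, y)) (axis j 1, 0)"
    unfolding dx_eq_frechet[OF smooth_xy_dy[OF assms(1,2)] assms(3)]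
    by (subst frechet_derivative_cong[OF assms(1,3)]) (auto simp: dy_eq_frechet[OF assms(2)])
  ultimately show ?thesis using frechet_derivative_commute[OF assms] by simp
qed

section \<open>Positive homogeneity in the supporting element\<close>

definition conic :: "((real^'n) \<times> (real^'n)) set \<Rightarrow> bool" where
  "conic S \<longleftrightarrow> (\<forall>x y t. (x, y) \<in> S \<and> t > 0 \<longrightarrow> (x, t *\<^sub>R y) \<in> S)"

text \<open>Natural degrees are enough: only 0, 1 and 2 occur, and functions of degree 0 are never
  differentiated further with a claim on the degree.\<close>

definition homogeneous :: "((real^'n) \<times> (real^'n)) set \<Rightarrow> nat \<Rightarrow> 'n xyfun \<Rightarrow> bool" where
  "homogeneous S k f \<longleftrightarrow> (\<forall>x y t. (x, y) \<in> S \<and> t > 0 \<longrightarrow> f x (t *\<^sub>R y) = t ^ k * f x y)"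

lemma homogeneousD: "homogeneous S k f \<Longrightarrow> (x, y) \<in> S \<Longrightarrow> t > 0 \<Longrightarrow> f x (t *\<^sub>R y) = t ^ k * f x y"
  by (simp add: homogeneous_def)

lemma conicD: "conic S \<Longrightarrow> (x, y) \<in> S \<Longrightarrow> t > 0 \<Longrightarrow> (x, t *\<^sub>R y) \<in> S"
  by (simp add: conic_def)

lemma homogeneous_dy:
  assumes "open S" "conic S" "smooth_xy S f" "homogeneous S (Suc k) f"
  shows "homogeneous S k (dy i f)"
  unfolding homogeneous_def dy_def
proof clarify
  fix x y and t :: real
  assume "(x, y) \<in> S" "t > 0"
  then show "partial i (f x) (t *\<^sub>R y) = t ^ k * partial i (f x) y"
    by (intro partial_scale[OF open_slices(2)[OF assms(1), of x]] smooth_xy_differentiable_snd[OF assms(3)])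
      (auto intro: conicD[OF assms(2)] simp: homogeneousD[OF assms(4)])
qed

lemma homogeneous_dx:
  assumes "open S" "conic S" "smooth_xy S f" "homogeneous S k f"
  shows "homogeneous S k (dx i f)"
  unfolding homogeneous_def
proof clarify
  fix x y and t :: real
  assume xy: "(x, y) \<in> S" and t: "t > 0"
  have "dx i f x (t *\<^sub>R y) = partial i (\<lambda>x. t ^ k * f x y) x"
    unfolding dx_def
    by (rule partial_cong[OF open_slices(1)[OF assms(1), of y]])
      (use xy t homogeneousD[OF assms(4)] in auto)
  also have "\<dots> = t ^ k * dx i f x y"
    unfolding dx_def
    by (rule trans[OF partial_eqI[OF has_derivative_mult_right]])
      (use xy smooth_xy_differentiable_fst[OF assms(3)] in \<open>auto simp: frechet_derivative_works[symmetric] partial_def\<close>)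
  finally show "dx i f x (t *\<^sub>R y) = t ^ k * dx i f x y" .
qed

lemma euler_dy:
  assumes "smooth_xy S f" "homogeneous S k f" "(x, y) \<in> S"
  shows "(\<Sum>i\<in>UNIV. y $ i * dy i f x y) = real k * f x y"
  unfolding dy_def
  by (rule euler_homogeneous)
    (use assms homogeneousD smooth_xy_differentiable_snd in blast)+

section \<open>Finsler metrics in a chart\<close>

text \<open>For smooth \<open>f\<close> this is \<open>d/dt (df/dy^r) - df/dx^r\<close> along a
  curve with velocity \<open>y\<close> and acceleration \<open>-2 G\<close>. \<open>G\<close>
  consists of numbers, not functions, since it is never differentiated.\<close>

definition euler_lagrange :: "('n \<Rightarrow> real) \<Rightarrow> 'n::finite \<Rightarrow> 'n xyfun \<Rightarrow> 'n xyfun" where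
  "euler_lagrange G r f x y = (\<Sum>j\<in>UNIV. y $ j * dy r (dx j f) x y) - dx r f x y
     - 2 * (\<Sum>s\<in>UNIV. G s * dy s (dy r f) x y)"

text \<open>The rate of change of \<open>f\<close> along the same curve.\<close>

definition spray_derivative :: "('n \<Rightarrow> real) \<Rightarrow> 'n::finite xyfun \<Rightarrow> 'n xyfun" where
  "spray_derivative G f x y = (\<Sum>j\<in>UNIV. y $ j * dx j f x y) - 2 * (\<Sum>s\<in>UNIV. G s * dy s f x y)"

lemma dy_dy_mult:
  assumes "open S" "smooth_xy S f" "smooth_xy S g" "(x, y) \<in> S"
  shows "dy s (dy r (\<lambda>x y. f x y * g x y)) x y = f x y * dy s (dy r g) x y + g x y * dy s (dy r f) x y
    + dy s f x y * dy r g x y + dy r f x y * dy s g x y"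
proof -
  have "dy s (dy r (\<lambda>x y. f x y * g x y)) x y = dy s (\<lambda>x y. f x y * dy r g x y + dy r f x y * g x y) x y"
    by (rule dy_cong[OF assms(1,4)]) (rule dy_mult[OF assms(2,3)])
  also have "\<dots> = (f x y * dy s (dy r g) x y + dy s f x y * dy r g x y)
      + (dy r f x y * dy s g x y + dy s (dy r f) x y * g x y)"
    using assms by (simp add: dy_add[of S] dy_mult[of S] smooth_xy_mult smooth_xy_dy)
  finally show ?thesis by simp
qed

lemma dy_dx_mult:
  assumes "open S" "smooth_xy S f" "smooth_xy S g" "(x, y) \<in> S"
  shows "dy r (dx j (\<lambda>x y. f x y * g x y)) x y = f x y * dy r (dx j g) x y + g x y * dy r (dx j f) x y
    + dy r f x y * dx j g x y + dx j f x y * dy r g x y"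
proof -
  have "dy r (dx j (\<lambda>x y. f x y * g x y)) x y = dy r (\<lambda>x y. f x y * dx j g x y + dx j f x y * g x y) x y"
    by (rule dy_cong[OF assms(1,4)]) (rule dx_mult[OF assms(2,3)])
  also have "\<dots> = (f x y * dy r (dx j g) x y + dy r f x y * dx j g x y)
      + (dx j f x y * dy r g x y + dy r (dx j f) x y * g x y)"
    using assms by (simp add: dy_add[of S] dy_mult[of S] smooth_xy_mult smooth_xy_dx)
  finally show ?thesis by simp
qed

text \<open>The operator fails to be a derivation only by terms containing \<open>dy r f\<close> or
  \<open>dy r g\<close>; these disappear after contraction with a vector along which
  \<open>f\<close> and \<open>g\<close> are critical.\<close>

lemma euler_lagrange_mult:
  assumes "open S" "smooth_xy S f" "smooth_xy S g" "(x, y) \<in> S"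
  shows "euler_lagrange G r (\<lambda>x y. f x y * g x y) x y
    = f x y * euler_lagrange G r g x y + g x y * euler_lagrange G r f x y
      + dy r f x y * spray_derivative G g x y + dy r g x y * spray_derivative G f x y"
  unfolding euler_lagrange_def spray_derivative_def
    dx_mult[OF assms(2-4)] dy_dx_mult[OF assms] dy_dy_mult[OF assms]
  by (simp add: algebra_simps sum.distrib sum_distrib_left sum_subtractf)

lemma euler_lagrange_cong:
  assumes S: "open S" "(x, y) \<in> S" and eq: "\<And>x y. (x, y) \<in> S \<Longrightarrow> f x y = g x y"
  shows "euler_lagrange G r f x y = euler_lagrange G r g x y"
proof -
  have "dy r (dx j f) x y = dy r (dx j g) x y" for j
    by (rule dy_cong[OF S]) (rule dx_cong[OF S(1) _ eq])
  moreover have "dy s (dy r f) x y = dy s (dy r g) x y" for s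
    by (rule dy_cong[OF S]) (rule dy_cong[OF S(1) _ eq])
  moreover have "dx r f x y = dx r g x y"
    by (rule dx_cong[OF S eq])
  ultimately show ?thesis by (simp add: euler_lagrange_def)
qed

locale finsler_chart =
  fixes S :: "((real^'n::finite) \<times> (real^'n)) set" and L :: "'n xyfun"
  assumes open_S: "open S" and conic_S: "conic S" and finsler: "finsler_metric S L"
begin

abbreviation "L2 \<equiv> \<lambda>x y. (L x y)^2"

lemma smooth_L: "smooth_xy S L"
  using finsler by (simp add: finsler_metric_def)

lemma homogeneous_L: "homogeneous S 1 L"
  using finsler by (simp add: finsler_metric_def homogeneous_def)

lemma smooth_L2: "smooth_xy S L2"
  unfolding power2_eq_square by (rule smooth_xy_mult[OF open_S smooth_L smooth_L])

lemma homogeneous_L2: "homogeneous S 2 L2"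
  using homogeneous_L by (auto simp: homogeneous_def power_mult_distrib)

lemmas smooth_dyL = smooth_xy_dy[OF open_S smooth_L]
lemmas smooth_dyL2 = smooth_xy_dy[OF open_S smooth_L2]
lemmas smooth_dxL2 = smooth_xy_dx[OF open_S smooth_L2]

lemma homogeneous_dyL: "homogeneous S 0 (dy i L)"
  by (rule homogeneous_dy[OF open_S conic_S smooth_L]) (use homogeneous_L in simp)

lemma homogeneous_dyL2: "homogeneous S 1 (dy i L2)"
  by (rule homogeneous_dy[OF open_S conic_S smooth_L2]) (use homogeneous_L2 in \<open>simp add: numeral_2_eq_2\<close>)

lemma homogeneous_gmet: "homogeneous S 0 (gmet L i j)"
  using homogeneous_dy[OF open_S conic_S smooth_dyL2, of 0 j i] homogeneous_dyL2[of j]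
  by (auto simp: gmet_def homogeneous_def)

lemma gmet_pos: "(x, y) \<in> S \<Longrightarrow> w \<noteq> 0 \<Longrightarrow> (\<Sum>i\<in>UNIV. \<Sum>j\<in>UNIV. gmet L i j x y * w $ i * w $ j) > 0"
  using finsler unfolding finsler_metric_def by blast

lemma gmet_sym: "(x, y) \<in> S \<Longrightarrow> gmet L i j x y = gmet L j i x y"
  unfolding gmet_def using dy_commute[OF open_S smooth_L2] by simp

lemma dy_L2: "(x, y) \<in> S \<Longrightarrow> dy i L2 x y = 2 * L x y * dy i L x y"
  unfolding power2_eq_square by (simp add: dy_mult[OF smooth_L smooth_L])

lemma gmet_eq: "(x, y) \<in> S \<Longrightarrow> gmet L i j x y = dy i L x y * dy j L x y + L x y * dy i (dy j L) x y"
  unfolding gmet_def power2_eq_square by (simp add: dy_dy_mult[OF open_S smooth_L smooth_L])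

text \<open>Euler's theorem for the derivatives of \<open>L2\<close>, which have degree 1 in
  \<open>y\<close>.\<close>

lemma gmet_supp:
  assumes "(x, y) \<in> S" shows "(\<Sum>j\<in>UNIV. gmet L i j x y * y $ j) = L x y * dy i L x y"
proof -
  have "(\<Sum>j\<in>UNIV. y $ j * dy j (dy i L2) x y) = dy i L2 x y"
    using euler_dy[OF smooth_dyL2 homogeneous_dyL2 assms] by simp
  moreover have "2 * (\<Sum>j\<in>UNIV. gmet L j i x y * y $ j) = (\<Sum>j\<in>UNIV. y $ j * dy j (dy i L2) x y)"
    by (simp add: gmet_def sum_distrib_left mult_ac)
  ultimately have "(\<Sum>j\<in>UNIV. gmet L j i x y * y $ j) = L x y * dy i L x y"
    by (simp add: dy_L2[OF assms])
  then show ?thesis using gmet_sym[OF assms] by simp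
qed

text \<open>Otherwise \<open>gmet_supp\<close> would make the quadratic form of the metric vanish at
  \<open>y\<close>.\<close>

lemma L_nonzero:
  assumes "(x, y) \<in> S" "y \<noteq> 0" shows "L x y \<noteq> 0"
proof
  assume "L x y = 0"
  then have "(\<Sum>j\<in>UNIV. gmet L i j x y * y $ j) = 0" for i by (simp add: gmet_supp[OF assms(1)])
  then have "(\<Sum>i\<in>UNIV. y $ i * (\<Sum>j\<in>UNIV. gmet L i j x y * y $ j)) = 0" by simp
  with gmet_pos[OF assms] show False by (simp add: sum_distrib_left mult_ac)
qed

lemma gmet_invertible:
  assumes "(x, y) \<in> S" shows "invertible (\<chi> k l. gmet L k l x y)"
proof -
  have "w = 0" if "(\<chi> k l. gmet L k l x y) *v w = 0" for w
  proof (rule ccontr)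
    assume "w \<noteq> 0"
    have "(\<Sum>j\<in>UNIV. gmet L i j x y * w $ j) = 0" for i
      using that by (simp add: matrix_vector_mult_def vec_eq_iff)
    then have "(\<Sum>i\<in>UNIV. w $ i * (\<Sum>j\<in>UNIV. gmet L i j x y * w $ j)) = 0" by simp
    with gmet_pos[OF assms \<open>w \<noteq> 0\<close>] show False by (simp add: sum_distrib_left mult_ac)
  qed
  then show ?thesis by (metis invertible_left_inverse matrix_left_invertible_ker)
qed

lemma gmet_ginv:
  assumes "(x, y) \<in> S"
  shows "(\<Sum>s\<in>UNIV. gmet L r s x y * ginv L s k x y) = (if r = k then 1 else 0)"
proof -
  let ?M = "\<chi> k l. gmet L k l x y"
  have "?M ** matrix_inv ?M = mat 1"
    using gmet_invertible[OF assms] unfolding invertible_def matrix_inv_def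
    by (rule someI_ex[THEN conjunct1])
  then have "(?M ** matrix_inv ?M) $ r $ k = mat 1 $ r $ k" by simp
  then show ?thesis by (simp add: matrix_matrix_mult_def ginv_def mat_def)
qed

lemma gmet_spray:
  assumes "(x, y) \<in> S"
  shows "4 * (\<Sum>s\<in>UNIV. gmet L r s x y * spray L s x y)
    = (\<Sum>j\<in>UNIV. y $ j * dy r (dx j L2) x y) - dx r L2 x y"
proof -
  define R where "R r = (\<Sum>j\<in>UNIV. y $ j * dy r (dx j L2) x y) - dx r L2 x y" for r
  have "4 * (\<Sum>s\<in>UNIV. gmet L r s x y * spray L s x y)
      = (\<Sum>s\<in>UNIV. \<Sum>k\<in>UNIV. gmet L r s x y * ginv L s k x y * R k)"
    by (simp add: spray_def R_def[symmetric] sum_distrib_left mult_ac)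
  also have "\<dots> = (\<Sum>k\<in>UNIV. (\<Sum>s\<in>UNIV. gmet L r s x y * ginv L s k x y) * R k)"
    by (subst sum.swap) (simp add: sum_distrib_right)
  also have "\<dots> = R r" by (simp add: gmet_ginv[OF assms] if_distrib[of "\<lambda>c. c * _"] cong: if_cong)
  finally show ?thesis by (simp add: R_def)
qed

text \<open>The expression measures how far \<open>G\<close> is from the spray of the metric. It
  vanishes for the metric's own spray; with the spray of another metric as \<open>G\<close> it is
  the lowered difference of the two.\<close>

lemma euler_lagrange_L2:
  assumes "(x, y) \<in> S"
  shows "euler_lagrange G r L2 x y = 4 * (\<Sum>s\<in>UNIV. gmet L r s x y * (spray L s x y - G s))"
proof -
  have "2 * (\<Sum>s\<in>UNIV. G s * dy s (dy r L2) x y) = 4 * (\<Sum>s\<in>UNIV. gmet L s r x y * G s)"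
    by (simp add: gmet_def sum_distrib_left mult_ac)
  then show ?thesis
    unfolding euler_lagrange_def gmet_spray[OF assms, symmetric]
    by (simp add: gmet_sym[OF assms, of _ r] right_diff_distrib sum_subtractf)
qed

section \<open>Homogeneity and differentiability of the spray, and the connection
  coefficients\<close>

lemma homogeneous_ginv: "homogeneous S 0 (ginv L i j)"
  using homogeneous_gmet by (simp add: homogeneous_def ginv_def)

lemma homogeneous_spray: "homogeneous S 2 (spray L i)"
proof -
  have dx: "homogeneous S 2 (dx j L2)" for j
    by (rule homogeneous_dx[OF open_S conic_S smooth_L2 homogeneous_L2])
  then have dydx: "homogeneous S 1 (dy r (dx j L2))" for r j
    by (intro homogeneous_dy[OF open_S conic_S smooth_dxL2]) (simp add: numeral_2_eq_2)
  show ?thesis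
    unfolding homogeneous_def
  proof clarify
    fix x y and t :: real
    assume *: "(x, y) \<in> S" "t > 0"
    show "spray L i x (t *\<^sub>R y) = t\<^sup>2 * spray L i x y"
      by (simp add: spray_def homogeneousD[OF homogeneous_ginv *] homogeneousD[OF dx *]
          homogeneousD[OF dydx *] sum_distrib_left right_diff_distrib power2_eq_square[of t] mult_ac)
  qed
qed

text \<open>One derivative in \<open>y\<close> is all that \<open>nonlin\<close> takes; for the
  inverse metric it comes from Cramer's rule.\<close>

lemma differentiable_spray:
  assumes "(x, y) \<in> S" shows "spray L i x differentiable (at y)"
proof -
  have g: "gmet L i j x differentiable (at y)" for i j
    using smooth_xy_differentiable_snd[OF smooth_xy_dy[OF open_S smooth_dyL2] assms]
    unfolding gmet_def by (intro differentiable_mult differentiable_const)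
  have "(\<lambda>y. matrix_inv (\<chi> k l. gmet L k l x y) $ i $ j) differentiable (at y)" for i j
    by (rule differentiable_matrix_inv[OF _ open_slices(2)[OF open_S, of x]])
      (use assms g gmet_invertible in auto)
  then have gi: "ginv L i j x differentiable (at y)" for i j
    unfolding ginv_def .
  show ?thesis
    unfolding spray_def
    by (intro differentiable_mult differentiable_const differentiable_sum differentiable_diff ballI gi
        smooth_xy_differentiable_snd[OF smooth_xy_dy[OF open_S smooth_dxL2] assms]
        smooth_xy_differentiable_snd[OF smooth_dxL2 assms]
        bounded_linear_imp_differentiable[OF bounded_linear_vec_nth]) simp_all
qed

text \<open>Euler's theorem for the spray, of degree 2.\<close>

lemma nonlin_supp:
  assumes "(x, y) \<in> S" shows "(\<Sum>j\<in>UNIV. y $ j * nonlin L i j x y) = 2 * spray L i x y"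
  using euler_homogeneous[OF differentiable_spray[OF assms], where k = 2]
    homogeneousD[OF homogeneous_spray assms]
  by (simp add: nonlin_def dy_def)

text \<open>This removes the connection coefficients from the gradient condition.\<close>

lemma hconn_sym:
  assumes "(x, y) \<in> S" shows "hconn L i j k x y = hconn L i k j x y"
proof -
  have "delta L r (gmet L j k) x y = delta L r (gmet L k j) x y" for r
    unfolding delta_def
    using dx_cong[OF open_S assms, of "gmet L j k" "gmet L k j"]
      dy_cong[OF open_S assms, of "gmet L j k" "gmet L k j"] by (simp add: gmet_sym)
  then show ?thesis by (simp add: hconn_def algebra_simps)
qed

end

section \<open>The Kropina change with an h-vector in a chart\<close>

locale h_vector_chart = finsler_chart S L
  for S :: "((real^'n::finite) \<times> (real^'n)) set" and L :: "'n xyfun" +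
  fixes b :: "real^'n \<Rightarrow> real^'n \<Rightarrow> real^'n" and \<rho> :: "'n xyfun"
  assumes nonzero: "(x, y) \<in> S \<Longrightarrow> y \<noteq> 0"
    and smooth_b: "smooth_on S (\<lambda>(x, y). b x y)"
    and vcov_b: "(x, y) \<in> S \<Longrightarrow> vcov L b i j x y = 0"
    and Cup_b: "(x, y) \<in> S \<Longrightarrow> L x y * (\<Sum>h\<in>UNIV. Cup L h i j x y * b x y $ h) = \<rho> x y * hang L i j x y"
    and \<rho>_nonzero: "(x, y) \<in> S \<Longrightarrow> \<rho> x y \<noteq> 0"
    and gradient: "(x, y) \<in> S \<Longrightarrow> hcov L b i j x y = hcov L b j i x y"
begin

section \<open>The function \<open>\<beta>\<close> and its derivatives\<close>

definition \<beta> :: "'n xyfun" where "\<beta> x y = (\<Sum>i\<in>UNIV. b x y $ i * y $ i)"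

lemmas smooth_bi = smooth_xy_component[OF open_S smooth_b]

lemma smooth_beta: "smooth_xy S \<beta>"
  unfolding \<beta>_def
  by (intro smooth_xy_sum smooth_xy_mult open_S smooth_bi smooth_xy_component_snd)

text \<open>The first h-vector condition turns the derivative into \<open>C^r_{ij} b_r\<close>; the
  second evaluates that, after cancelling the nonzero factor \<open>L\<close>.\<close>

lemma dy_b:
  assumes "(x, y) \<in> S"
  shows "dy j (\<lambda>x y. b x y $ i) x y = \<rho> x y * dy i (dy j L) x y"
proof -
  have "dy j (\<lambda>x y. b x y $ i) x y = (\<Sum>r\<in>UNIV. Cup L r i j x y * b x y $ r)"
    using vcov_b[OF assms, of i j] by (simp add: vcov_def)
  then show ?thesis
    using Cup_b[OF assms, of i j] L_nonzero[OF assms nonzero[OF assms]] by (simp add: hang_def)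
qed

text \<open>The derivatives of \<open>L\<close> have degree 0, so the Hessian of \<open>L\<close>
  annihilates \<open>y\<close>.\<close>

lemma supp_dy_b:
  assumes "(x, y) \<in> S"
  shows "(\<Sum>i\<in>UNIV. y $ i * dy j (\<lambda>x y. b x y $ i) x y) = 0"
proof -
  have "(\<Sum>i\<in>UNIV. y $ i * dy j (\<lambda>x y. b x y $ i) x y) = \<rho> x y * (\<Sum>i\<in>UNIV. y $ i * dy i (dy j L) x y)"
    by (simp add: dy_b[OF assms] sum_distrib_left mult_ac)
  then show ?thesis using euler_dy[OF smooth_dyL homogeneous_dyL assms] by simp
qed

lemma dx_beta:
  assumes "(x, y) \<in> S"
  shows "dx j \<beta> x y = (\<Sum>i\<in>UNIV. y $ i * dx j (\<lambda>x y. b x y $ i) x y)"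
proof -
  have "dx j \<beta> x y = (\<Sum>i\<in>UNIV. dx j (\<lambda>x y. b x y $ i * y $ i) x y)"
    unfolding \<beta>_def[abs_def]
    by (rule dx_sum[OF smooth_xy_mult[OF open_S smooth_bi smooth_xy_component_snd] assms])
  moreover have "dx j (\<lambda>x y. b x y $ i * y $ i) x y = y $ i * dx j (\<lambda>x y. b x y $ i) x y" for i
    by (simp add: dx_mult[OF smooth_bi smooth_xy_component_snd assms] dx_component_snd)
  ultimately show ?thesis by simp
qed

text \<open>As for a one-form on the manifold: although \<open>b\<close> depends on
  \<open>y\<close>, the extra term vanishes by \<open>supp_dy_b\<close>.\<close>

lemma dy_beta:
  assumes "(x, y) \<in> S" shows "dy j \<beta> x y = b x y $ j"
proof -
  have "dy j \<beta> x y = (\<Sum>i\<in>UNIV. dy j (\<lambda>x y. b x y $ i * y $ i) x y)"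
    unfolding \<beta>_def[abs_def]
    by (rule dy_sum[OF smooth_xy_mult[OF open_S smooth_bi smooth_xy_component_snd] assms])
  also have "\<dots> = (\<Sum>i\<in>UNIV. b x y $ i * (if j = i then 1 else 0))
      + (\<Sum>i\<in>UNIV. y $ i * dy j (\<lambda>x y. b x y $ i) x y)"
    by (simp add: dy_mult[OF smooth_bi smooth_xy_component_snd assms] dy_component_snd sum.distrib
        mult.commute[of "dy _ _ _ _"])
  also have "\<dots> = b x y $ j" by (simp add: supp_dy_b[OF assms] mult_delta_right)
  finally show ?thesis .
qed

lemma dy_dy_beta:
  assumes "(x, y) \<in> S" shows "dy s (dy r \<beta>) x y = \<rho> x y * dy s (dy r L) x y"
proof -
  have "dy s (dy r \<beta>) x y = dy s (\<lambda>x y. b x y $ r) x y"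
    by (rule dy_cong[OF open_S assms dy_beta])
  then show ?thesis by (simp add: dy_b[OF assms] dy_commute[OF open_S smooth_L assms])
qed

text \<open>The only place where the gradient condition enters: the geodesics of \<open>L\<close> are extremals of \<open>\<beta>\<close> too.\<close>

lemma euler_lagrange_beta:
  assumes xy: "(x, y) \<in> S"
  shows "euler_lagrange (\<lambda>s. spray L s x y) r \<beta> x y = 0"
proof -
  define bi where "bi i = (\<lambda>x y. b x y $ i)" for i
  \<comment> \<open>The terms with \<open>hconn\<close> cancel by symmetry.\<close>
  have grad: "dx j (bi i) x y - (\<Sum>h\<in>UNIV. dy h (bi i) x y * nonlin L h j x y)
      = dx i (bi j) x y - (\<Sum>h\<in>UNIV. dy h (bi j) x y * nonlin L h i x y)" for i j
    using gradient[OF xy, of i j] hconn_sym[OF xy, of _ i j] by (simp add: hcov_def bi_def)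
  have "dy r (dx j \<beta>) x y = dx j (bi r) x y" for j
    unfolding dy_dx_commute[OF open_S smooth_beta xy] bi_def
    by (rule dx_cong[OF open_S xy dy_beta])
  moreover have "dy s (dy r \<beta>) x y = dy s (bi r) x y" for s
    unfolding bi_def by (rule dy_cong[OF open_S xy dy_beta])
  \<comment> \<open>Contracted with \<open>y\<close>, the nonlinear connection gives twice the
    spray, hence the acceleration term of the Euler-Lagrange expression.\<close>
  moreover have "2 * (\<Sum>s\<in>UNIV. spray L s x y * dy s (bi r) x y)
      = (\<Sum>j\<in>UNIV. y $ j * (\<Sum>h\<in>UNIV. dy h (bi r) x y * nonlin L h j x y))"
  proof -
    have "2 * (\<Sum>s\<in>UNIV. spray L s x y * dy s (bi r) x y)
        = (\<Sum>h\<in>UNIV. (\<Sum>j\<in>UNIV. y $ j * nonlin L h j x y) * dy h (bi r) x y)"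
      by (simp add: nonlin_supp[OF xy] sum_distrib_left mult.assoc)
    also have "\<dots> = (\<Sum>h\<in>UNIV. \<Sum>j\<in>UNIV. y $ j * (dy h (bi r) x y * nonlin L h j x y))"
      by (simp add: sum_distrib_left sum_distrib_right mult_ac)
    also have "\<dots> = (\<Sum>j\<in>UNIV. y $ j * (\<Sum>h\<in>UNIV. dy h (bi r) x y * nonlin L h j x y))"
      by (subst sum.swap) (simp add: sum_distrib_left)
    finally show ?thesis .
  qed
  \<comment> \<open>The corresponding term with the indices exchanged drops out, because
    \<open>y\<close> annihilates the vertical derivatives of \<open>b\<close>.\<close>
  moreover have "(\<Sum>j\<in>UNIV. y $ j * (\<Sum>h\<in>UNIV. dy h (bi j) x y * nonlin L h r x y)) = 0"
  proof -
    have "(\<Sum>j\<in>UNIV. y $ j * (\<Sum>h\<in>UNIV. dy h (bi j) x y * nonlin L h r x y))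
        = (\<Sum>h\<in>UNIV. \<Sum>j\<in>UNIV. y $ j * dy h (bi j) x y * nonlin L h r x y)"
      by (subst sum.swap) (simp add: sum_distrib_left mult_ac)
    also have "\<dots> = 0" using supp_dy_b[OF xy] by (simp add: bi_def sum_distrib_right[symmetric])
    finally show ?thesis .
  qed
  moreover have "(\<Sum>j\<in>UNIV. y $ j * (dx j (bi r) x y - (\<Sum>h\<in>UNIV. dy h (bi r) x y * nonlin L h j x y)))
     = (\<Sum>j\<in>UNIV. y $ j * (dx r (bi j) x y - (\<Sum>h\<in>UNIV. dy h (bi j) x y * nonlin L h r x y)))"
    by (simp add: grad[of _ r])
  ultimately show ?thesis
    by (simp add: euler_lagrange_def dx_beta[OF xy] bi_def[symmetric] right_diff_distrib sum_subtractf)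
qed

text \<open>If \<open>b\<close> vanished, the second h-vector condition with \<open>\<rho>\<close>
  nonzero would kill the Hessian of \<open>L\<close>. The metric would then be the square of the
  form \<open>dy i L\<close>, which vanishes on \<open>N\<close> by orthogonality to
  \<open>y\<close>, contradicting positivity.\<close>

lemma b_nonzero_normal:
  assumes xy: "(x, y) \<in> S" and N: "N \<noteq> 0"
    and ortho: "(\<Sum>r\<in>UNIV. (\<Sum>s\<in>UNIV. gmet L r s x y * y $ s) * N $ r) = 0"
  shows "b x y \<noteq> 0"
proof
  assume "b x y = 0"
  then have "dy i (dy j L) x y = 0" for i j
    using Cup_b[OF xy, of i j] \<rho>_nonzero[OF xy] L_nonzero[OF xy nonzero[OF xy]] by (simp add: hang_def)
  then have "(\<Sum>i\<in>UNIV. \<Sum>j\<in>UNIV. gmet L i j x y * N $ i * N $ j)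
      = (\<Sum>i\<in>UNIV. dy i L x y * N $ i) * (\<Sum>j\<in>UNIV. dy j L x y * N $ j)"
    by (simp add: gmet_eq[OF xy] sum_product mult_ac)
  moreover have "L x y * (\<Sum>i\<in>UNIV. dy i L x y * N $ i) = 0"
    using ortho unfolding gmet_supp[OF xy] by (simp add: sum_distrib_left mult_ac)
  ultimately show False
    using gmet_pos[OF xy N] L_nonzero[OF xy nonzero[OF xy]] by simp
qed

end

text \<open>\<open>\<beta> K = L\<^sup>2\<close>, and along \<open>N\<close> all of \<open>L\<close>, \<open>\<beta>\<close>, \<open>K\<close> are critical, so that both the contracted
  Euler-Lagrange operator and the contracted Hessian act on them as derivations.\<close>

locale kropina_chart = h_vector_chart S L b \<rho> + K: finsler_chart T K
  for S :: "((real^'n::finite) \<times> (real^'n)) set" and L b \<rho> T and K :: "'n xyfun" +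
  assumes T_def: "T = {(x, y) \<in> S. \<beta> x y \<noteq> 0}"
    and K_def: "(x, y) \<in> T \<Longrightarrow> K x y = (L x y)^2 / \<beta> x y"
begin

lemma spray_kropina:
  assumes xy: "(x, y) \<in> T" and N: "N \<noteq> 0"
    and ortho: "(\<Sum>r\<in>UNIV. (\<Sum>s\<in>UNIV. gmet L r s x y * y $ s) * N $ r) = 0"
    and tangent: "(\<Sum>r\<in>UNIV. b x y $ r * N $ r) = 0"
  shows "(\<Sum>s\<in>UNIV. (\<Sum>r\<in>UNIV. gmet L s r x y * N $ r) * (spray K s x y - spray L s x y)) = 0"
proof -
  have sub: "T \<subseteq> S" using T_def by auto
  have xyS: "(x, y) \<in> S" using xy sub by auto
  have \<beta>0: "\<beta> x y \<noteq> 0" using xy T_def by auto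
  have L0: "L x y \<noteq> 0" by (rule L_nonzero[OF xyS nonzero[OF xyS]])
  have sL: "smooth_xy T L" and sb: "smooth_xy T \<beta>"
    using smooth_on_subset[OF smooth_L sub] smooth_on_subset[OF smooth_beta sub] .
  note sK = K.smooth_L and op = K.open_S
  \<comment> \<open>In product form only product rules are needed, and facts about \<open>K\<close>
    follow by dividing by \<open>\<beta>\<close>.\<close>
  have eq: "(L x y)\<^sup>2 = \<beta> x y * K x y" if "(x, y) \<in> T" for x y
    using K_def[OF that] that T_def by auto
  define G where "G s = spray L s x y" for s
  \<comment> \<open>\<open>D\<close>, \<open>E\<close> and \<open>H\<close> are the differential,
    the Euler-Lagrange expression along the spray of \<open>L\<close>, and the Hessian, each
    contracted with \<open>N\<close>.\<close>
  define D where "D f = (\<Sum>r\<in>UNIV. N $ r * dy r f x y)" for f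
  define E where "E f = (\<Sum>r\<in>UNIV. N $ r * euler_lagrange G r f x y)" for f
  define H where "H s f = (\<Sum>r\<in>UNIV. N $ r * dy s (dy r f) x y)" for s f
  define \<nu> where "\<nu> s = (\<Sum>r\<in>UNIV. gmet L s r x y * N $ r)" for s
  have D_mult: "D (\<lambda>x y. f x y * g x y) = f x y * D g + g x y * D f"
    if "smooth_xy T f" "smooth_xy T g" for f g
    by (simp add: D_def dy_mult[OF that xy] sum.distrib sum_distrib_left algebra_simps)
  have E_mult: "E (\<lambda>x y. f x y * g x y) = f x y * E g + g x y * E f"
    if "smooth_xy T f" "smooth_xy T g" "D f = 0" "D g = 0" for f g
  proof -
    have "E (\<lambda>x y. f x y * g x y) = f x y * E g + g x y * E f
        + D f * spray_derivative G g x y + D g * spray_derivative G f x y"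
      by (simp add: E_def D_def euler_lagrange_mult[OF op that(1,2) xy] sum.distrib sum_distrib_left
          sum_distrib_right algebra_simps)
    then show ?thesis using that by simp
  qed
  have H_mult: "H s (\<lambda>x y. f x y * g x y) = f x y * H s g + g x y * H s f"
    if "smooth_xy T f" "smooth_xy T g" "D f = 0" "D g = 0" for s f g
  proof -
    have "H s (\<lambda>x y. f x y * g x y) = f x y * H s g + g x y * H s f + dy s f x y * D g + D f * dy s g x y"
      by (simp add: H_def D_def dy_dy_mult[OF op that(1,2) xy] sum.distrib sum_distrib_left
          sum_distrib_right algebra_simps)
    then show ?thesis using that by simp
  qed
  have DL: "D L = 0"
  proof -
    have "L x y * D L = 0"
      using ortho unfolding gmet_supp[OF xyS] by (simp add: D_def sum_distrib_left mult_ac)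
    with L0 show ?thesis by simp
  qed
  have DL2: "D L2 = 0"
    unfolding power2_eq_square by (simp add: D_mult[OF sL sL] DL)
  have Db: "D \<beta> = 0"
    using tangent by (simp add: D_def dy_beta[OF xyS] mult.commute)
  have cong_D: "D L2 = D (\<lambda>x y. \<beta> x y * K x y)"
    unfolding D_def by (intro sum.cong refl arg_cong2[where f = "(*)"] dy_cong[OF op xy eq])
  have cong_E: "E L2 = E (\<lambda>x y. \<beta> x y * K x y)"
    unfolding E_def by (intro sum.cong refl arg_cong2[where f = "(*)"] euler_lagrange_cong[OF op xy eq])
  have cong_H: "H s L2 = H s (\<lambda>x y. \<beta> x y * K x y)" for s
    unfolding H_def
    by (intro sum.cong refl arg_cong2[where f = "(*)"] dy_cong[OF op xy] dy_cong[OF op _ eq])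
  have DK: "D K = 0"
    using cong_D \<beta>0 by (simp add: D_mult[OF sb sK] DL2 Db)
  have EL2: "E L2 = 0"
    by (simp add: E_def euler_lagrange_L2[OF xyS] G_def)
  have Eb: "E \<beta> = 0"
    using euler_lagrange_beta[OF xyS] by (simp add: E_def G_def[abs_def])
  have EK: "E K = 0"
    using cong_E \<beta>0 by (simp add: E_mult[OF sb sK Db DK] EL2 Eb)
  have EK2: "E (\<lambda>x y. (K x y)\<^sup>2) = 0"
    unfolding power2_eq_square by (simp add: E_mult[OF sK sK DK DK] EK)
  have HL2: "H s L2 = 2 * \<nu> s" for s
    by (simp add: H_def \<nu>_def gmet_def sum_distrib_left mult_ac)
  have "H s L2 = 2 * L x y * H s L" for s
    unfolding power2_eq_square by (simp add: H_mult[OF sL sL DL DL])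
  then have HL: "L x y * H s L = \<nu> s" for s using HL2[of s] by simp
  have Hb: "H s \<beta> = \<rho> x y * H s L" for s
    by (simp add: H_def dy_dy_beta[OF xyS] sum_distrib_left mult_ac)
  \<comment> \<open>Apply \<open>H\<close> to \<open>L2\<close> as \<open>\<beta> K\<close>; the
    Hessians of \<open>\<beta>\<close> and \<open>L\<close> are proportional, so every term is a
    multiple of \<open>\<nu>\<close>.\<close>
  have HK: "\<beta> x y * H s K = (2 - K x y * \<rho> x y / L x y) * \<nu> s" for s
  proof -
    have "2 * \<nu> s = \<beta> x y * H s K + K x y * (\<rho> x y * H s L)"
      using cong_H[of s] by (simp add: H_mult[OF sb sK Db DK] HL2 Hb)
    moreover have "H s L = \<nu> s / L x y" using HL[of s] L0 by (simp add: field_simps)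
    ultimately show ?thesis by (simp add: algebra_simps)
  qed
  \<comment> \<open>\<open>p\<close> is the ratio between lowering \<open>N\<close> with the metric
    of \<open>K\<close> and with that of \<open>L\<close>.\<close>
  define p where "p = K x y * (2 - K x y * \<rho> x y / L x y) / \<beta> x y"
  have HK2: "H s (\<lambda>x y. (K x y)\<^sup>2) = 2 * p * \<nu> s" for s
  proof -
    have "H s (\<lambda>x y. (K x y)\<^sup>2) = 2 * K x y * H s K"
      unfolding power2_eq_square by (simp add: H_mult[OF sK sK DK DK])
    also have "H s K = (2 - K x y * \<rho> x y / L x y) * \<nu> s / \<beta> x y"
      using HK[of s] \<beta>0 by (simp add: eq_divide_eq mult.commute)
    finally show ?thesis by (simp add: p_def)
  qed
  have gK: "(\<Sum>r\<in>UNIV. gmet K s r x y * N $ r) = p * \<nu> s" for s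
  proof -
    have "H s (\<lambda>x y. (K x y)\<^sup>2) = 2 * (\<Sum>r\<in>UNIV. gmet K s r x y * N $ r)"
      by (simp add: H_def gmet_def sum_distrib_left mult_ac)
    with HK2[of s] show ?thesis by simp
  qed
  \<comment> \<open>The formula for \<open>p\<close> does not exclude zero; positivity of the metric
    of \<open>K\<close> on \<open>N\<close> does.\<close>
  have "p \<noteq> 0"
  proof
    assume "p = 0"
    then have "(\<Sum>s\<in>UNIV. N $ s * (\<Sum>r\<in>UNIV. gmet K s r x y * N $ r)) = 0" by (simp add: gK)
    with K.gmet_pos[OF xy N] show False by (simp add: sum_distrib_left mult_ac)
  qed
  moreover define P where "P s = spray K s x y - G s" for s
  have gK_sym: "(\<Sum>r\<in>UNIV. gmet K s r x y * N $ r) = (\<Sum>r\<in>UNIV. N $ r * gmet K r s x y)" for s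
    by (simp add: K.gmet_sym[OF xy, of s] mult.commute)
  \<comment> \<open>By symmetry of the metric of \<open>K\<close>, the factor \<open>p \<nu>\<close>
    applied to the difference of sprays equals \<open>E\<close> of the square of
    \<open>K\<close>.\<close>
  have "4 * p * (\<Sum>s\<in>UNIV. \<nu> s * P s) = 0"
  proof -
    have "4 * p * (\<Sum>s\<in>UNIV. \<nu> s * P s)
        = 4 * (\<Sum>s\<in>UNIV. (\<Sum>r\<in>UNIV. gmet K s r x y * N $ r) * P s)"
      unfolding gK by (simp add: sum_distrib_left mult_ac)
    also have "\<dots> = 4 * (\<Sum>s\<in>UNIV. \<Sum>r\<in>UNIV. N $ r * gmet K r s x y * P s)"
      unfolding gK_sym by (simp add: sum_distrib_right)
    also have "\<dots> = (\<Sum>r\<in>UNIV. N $ r * (4 * (\<Sum>s\<in>UNIV. gmet K r s x y * P s)))"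
      by (subst sum.swap) (simp add: sum_distrib_left mult_ac)
    also have "\<dots> = E (\<lambda>x y. (K x y)\<^sup>2)"
      by (simp add: E_def K.euler_lagrange_L2[OF xy] P_def)
    finally show ?thesis using EK2 by simp
  qed
  ultimately show ?thesis by (simp add: \<nu>_def G_def P_def)
qed

end

section \<open>Hypersurfaces\<close>

text \<open>The covectors in question form the orthogonal complement of the column space, whose
  dimension is \<open>n - (n - 1) = 1\<close>.\<close>

lemma annihilator_line:
  fixes B :: "real^'m::finite^'n::finite"
  assumes rank: "rank B = CARD('m)" and card: "CARD('n) = CARD('m) + 1"
  obtains \<nu> where "\<nu> \<noteq> 0" "\<And>w. (\<forall>\<alpha>. (\<Sum>i\<in>UNIV. w $ i * B $ i $ \<alpha>) = 0) \<longleftrightarrow> (\<exists>c. w = c *\<^sub>R \<nu>)"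
proof -
  define R where "R = range ((*v) B)"
  define W where "W = {w. \<forall>x\<in>R. orthogonal x w}"
  have "subspace R" unfolding R_def by (intro linear_subspace_image) auto
  then have "dim W + dim R = CARD('n)"
    using dim_subspace_orthogonal_to_vectors[of R UNIV] by (simp add: W_def)
  then have "dim W = 1" using rank card by (simp add: R_def rank_dim_range)
  have "subspace W"
    unfolding W_def by (auto simp: subspace_def orthogonal_clauses)
  obtain C where C: "C \<subseteq> W" "independent C" "W \<subseteq> span C" "card C = dim W"
    using basis_exists by blast
  then obtain \<nu> where "C = {\<nu>}" using \<open>dim W = 1\<close> by (metis card_1_singletonE)
  then have "\<nu> \<noteq> 0" "W = span {\<nu>}"
    using C span_minimal[OF C(1) \<open>subspace W\<close>] by (auto simp: dependent_single)
  have "(\<forall>\<alpha>. (\<Sum>i\<in>UNIV. w $ i * B $ i $ \<alpha>) = 0) \<longleftrightarrow> w \<in> W" for w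
  proof -
    have "(\<forall>\<alpha>. (\<Sum>i\<in>UNIV. w $ i * B $ i $ \<alpha>) = 0) \<longleftrightarrow> w v* B = 0"
      by (simp add: vec_eq_iff vector_matrix_mult_def mult.commute)
    also have "\<dots> \<longleftrightarrow> (\<forall>v. (w v* B) \<bullet> v = 0)"
      by (metis inner_eq_zero_iff inner_zero_left)
    also have "\<dots> \<longleftrightarrow> w \<in> W"
      unfolding dot_lmul_matrix by (auto simp: W_def R_def orthogonal_def inner_commute)
    finally show ?thesis .
  qed
  with \<open>\<nu> \<noteq> 0\<close> \<open>W = span {\<nu>}\<close> show thesis
    by (intro that[of \<nu>]) (auto simp: span_singleton)
qed

lemma bounded_linear_supp_elem: "bounded_linear (supp_elem X u)"
proof -
  have "supp_elem X u = (*v) (\<chi> i \<alpha>. Bproj X i \<alpha> u)"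
    by (simp add: fun_eq_iff supp_elem_def matrix_vector_mult_def)
  then show ?thesis by (simp add: matrix_vector_mul_bounded_linear)
qed

lemma supp_elem_axis: "supp_elem X u (axis \<alpha> 1) $ i = Bproj X i \<alpha> u"
  by (simp add: supp_elem_def axis_def if_distrib[of "\<lambda>c. _ * c"] cong: if_cong)

lemma Bproj2_sym:
  assumes "open U" "smooth_on U X" "u \<in> U"
  shows "Bproj2 X i \<alpha> \<beta> u = Bproj2 X i \<beta> \<alpha> u"
  unfolding Bproj2_def partial_def
  using frechet_derivative_commute[OF assms(1) smooth_on_bounded_linear_compose[OF assms(1) bounded_linear_vec_nth assms(2)] assms(3)] .

text \<open>A conormal \<open>\<nu>\<close> depends neither on the metric nor on \<open>v\<close>, in contrast to the unit normal, whose
  covector \<open>N\<^sub>i\<close> is a nonzero multiple of \<open>\<nu>\<close>.\<close>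

definition conormal_curv :: "'n::finite xyfun \<Rightarrow> (real^'m::finite \<Rightarrow> real^'n) \<Rightarrow> real^'m \<Rightarrow> real^'n \<Rightarrow> real^'m \<Rightarrow> 'm \<Rightarrow> real"
  where "conormal_curv L X u \<nu> v \<alpha> = (\<Sum>i\<in>UNIV. \<nu> $ i * ((\<Sum>\<beta>\<in>UNIV. Bproj2 X i \<beta> \<alpha> u * v $ \<beta>) +
         (\<Sum>j\<in>UNIV. nonlin L i j (X u) (supp_elem X u v) * Bproj X j \<alpha> u)))"

text \<open>\<open>\<nu>\<close> applied to \<open>x'' + 2 G\<close> for any curve in the
  hypersurface with velocity \<open>v\<close>; the part with \<open>u''\<close> is tangent and drops
  out. Up to a nonzero factor this is \<open>H_0\<close>.\<close>

definition conormal_accel :: "'n::finite xyfun \<Rightarrow> (real^'m::finite \<Rightarrow> real^'n) \<Rightarrow> real^'m \<Rightarrow> real^'n \<Rightarrow> real^'m \<Rightarrow> real"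
  where "conormal_accel L X u \<nu> v = (\<Sum>i\<in>UNIV. \<nu> $ i *
    ((\<Sum>\<alpha>\<in>UNIV. \<Sum>\<beta>\<in>UNIV. Bproj2 X i \<alpha> \<beta> u * (v $ \<alpha> * v $ \<beta>)) + 2 * spray L i (X u) (supp_elem X u v)))"

locale conormal =
  fixes X :: "real^'m::finite \<Rightarrow> real^'n::finite" and u :: "real^'m" and \<nu> :: "real^'n"
  assumes \<nu>_nonzero: "\<nu> \<noteq> 0"
    and annihilator: "(\<forall>\<alpha>. (\<Sum>i\<in>UNIV. w $ i * Bproj X i \<alpha> u) = 0) \<longleftrightarrow> (\<exists>c. w = c *\<^sub>R \<nu>)"
    and B2_sym: "Bproj2 X i \<alpha> \<beta> u = Bproj2 X i \<beta> \<alpha> u"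
begin

lemma conormal_supp: "(\<Sum>i\<in>UNIV. \<nu> $ i * supp_elem X u v $ i) = 0"
proof -
  have "(\<Sum>i\<in>UNIV. \<nu> $ i * Bproj X i \<alpha> u) = 0" for \<alpha>
    using annihilator[of \<nu>] by (metis scaleR_one)
  moreover have "(\<Sum>i\<in>UNIV. \<nu> $ i * supp_elem X u v $ i)
      = (\<Sum>\<alpha>\<in>UNIV. (\<Sum>i\<in>UNIV. \<nu> $ i * Bproj X i \<alpha> u) * v $ \<alpha>)"
    by (subst sum_distrib_right, subst sum.swap) (simp add: supp_elem_def sum_distrib_left mult_ac)
  ultimately show ?thesis by simp
qed

end

locale finsler_conormal = finsler_chart S L + conormal X u \<nu>
  for S :: "((real^'n::finite) \<times> (real^'n)) set" and L and X :: "real^'m::finite \<Rightarrow> real^'n" and u \<nu>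
begin

text \<open>Raise the index of \<open>\<nu>\<close> and normalise. Without existence, conditions
  quantified over all unit normals could hold vacuously.\<close>

lemma unit_normal_exists:
  assumes "(X u, supp_elem X u v) \<in> S"
  obtains N where "unit_normal L X u v N"
proof -
  let ?g = "\<lambda>i j. gmet L i j (X u) (supp_elem X u v)"
  define w where "w = (\<chi> s. \<Sum>k\<in>UNIV. ginv L s k (X u) (supp_elem X u v) * \<nu> $ k)"
  have gw: "(\<Sum>j\<in>UNIV. ?g i j * w $ j) = \<nu> $ i" for i
  proof -
    have "(\<Sum>j\<in>UNIV. ?g i j * w $ j)
        = (\<Sum>k\<in>UNIV. (\<Sum>j\<in>UNIV. ?g i j * ginv L j k (X u) (supp_elem X u v)) * \<nu> $ k)"
      by (subst sum_distrib_right, subst sum.swap) (simp add: w_def sum_distrib_left mult_ac)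
    then show ?thesis by (simp add: gmet_ginv[OF assms] if_distrib[of "\<lambda>c. c * _"] cong: if_cong)
  qed
  have "w \<noteq> 0"
  proof
    assume "w = 0"
    then have "\<nu> $ i = 0" for i using gw[of i] by simp
    then show False using \<nu>_nonzero by (simp add: vec_eq_iff)
  qed
  define q where "q = (\<Sum>i\<in>UNIV. \<Sum>j\<in>UNIV. ?g i j * w $ i * w $ j)"
  have q: "q > 0" unfolding q_def by (rule gmet_pos[OF assms \<open>w \<noteq> 0\<close>])
  have "unit_normal L X u v ((1 / sqrt q) *\<^sub>R w)"
    unfolding unit_normal_def
  proof (intro conjI allI)
    fix \<alpha>
    have "(\<Sum>i\<in>UNIV. \<Sum>j\<in>UNIV. ?g i j * Bproj X i \<alpha> u * ((1 / sqrt q) *\<^sub>R w) $ j)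
        = (1 / sqrt q) * (\<Sum>i\<in>UNIV. (\<Sum>j\<in>UNIV. ?g i j * w $ j) * Bproj X i \<alpha> u)"
      by (simp add: sum_distrib_left sum_distrib_right mult_ac)
    also have "\<dots> = 0" unfolding gw using annihilator[of \<nu>] by (metis mult_zero_right scaleR_one)
    finally show "(\<Sum>i\<in>UNIV. \<Sum>j\<in>UNIV. ?g i j * Bproj X i \<alpha> u * ((1 / sqrt q) *\<^sub>R w) $ j) = 0" .
  next
    have "(\<Sum>i\<in>UNIV. \<Sum>j\<in>UNIV. ?g i j * ((1 / sqrt q) *\<^sub>R w) $ i * ((1 / sqrt q) *\<^sub>R w) $ j)
        = (1 / sqrt q) * (1 / sqrt q) * q"
      unfolding q_def sum_distrib_left by (simp add: mult_ac)
    also have "\<dots> = 1" using q by simp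
    finally show "(\<Sum>i\<in>UNIV. \<Sum>j\<in>UNIV. ?g i j * ((1 / sqrt q) *\<^sub>R w) $ i * ((1 / sqrt q) *\<^sub>R w) $ j) = 1" .
  qed
  then show thesis by (rule that)
qed

text \<open>\<open>N_i\<close> annihilates the tangent vectors, hence is a multiple of
  \<open>\<nu>\<close>; \<open>N_i N^i = 1\<close> shows that the factor is nonzero.\<close>

lemma unit_normal_covector:
  assumes "unit_normal L X u v N"
  obtains \<kappa> where "\<kappa> \<noteq> 0"
    "\<And>i. (\<Sum>j\<in>UNIV. gmet L i j (X u) (supp_elem X u v) * N $ j) = \<kappa> * \<nu> $ i"
    "\<kappa> * (\<Sum>i\<in>UNIV. \<nu> $ i * N $ i) = 1"
proof -
  let ?g = "\<lambda>i j. gmet L i j (X u) (supp_elem X u v)"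
  let ?w = "\<chi> i. \<Sum>j\<in>UNIV. ?g i j * N $ j"
  have "(\<Sum>i\<in>UNIV. ?w $ i * Bproj X i \<alpha> u) = 0" for \<alpha>
    using assms unfolding unit_normal_def by (simp add: sum_distrib_left sum_distrib_right mult_ac)
  then obtain \<kappa> where "?w = \<kappa> *\<^sub>R \<nu>" using annihilator by blast
  then have gN: "(\<Sum>j\<in>UNIV. ?g i j * N $ j) = \<kappa> * \<nu> $ i" for i by (simp add: vec_eq_iff)
  have "1 = (\<Sum>i\<in>UNIV. (\<Sum>j\<in>UNIV. ?g i j * N $ j) * N $ i)"
    using assms unfolding unit_normal_def by (simp add: sum_distrib_left sum_distrib_right mult_ac)
  then have 1: "\<kappa> * (\<Sum>i\<in>UNIV. \<nu> $ i * N $ i) = 1"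
    unfolding gN by (simp add: sum_distrib_left mult_ac)
  then have "\<kappa> \<noteq> 0" by auto
  from that[OF this gN 1] show thesis .
qed

lemma open_supp: "open {v. (X u, supp_elem X u v) \<in> S}"
proof -
  have "open ((\<lambda>v. (X u, supp_elem X u v)) -` S)"
    by (intro open_vimage open_S continuous_on_Pair continuous_on_const
        linear_continuous_on bounded_linear_supp_elem)
  then show ?thesis by (simp add: vimage_def)
qed

text \<open>The case \<open>k = v\<close> gives \<open>conormal_accel\<close>; general
  \<open>k\<close> is needed for its derivative in direction \<open>k\<close>.\<close>

lemma conormal_curv_contract:
  "(\<Sum>\<alpha>\<in>UNIV. k $ \<alpha> * conormal_curv L X u \<nu> v \<alpha>) = (\<Sum>i\<in>UNIV. \<nu> $ i *
    ((\<Sum>\<alpha>\<in>UNIV. \<Sum>\<beta>\<in>UNIV. Bproj2 X i \<alpha> \<beta> u * (k $ \<alpha> * v $ \<beta>))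
      + (\<Sum>j\<in>UNIV. supp_elem X u k $ j * nonlin L i j (X u) (supp_elem X u v))))"
proof -
  have swap: "(\<Sum>\<alpha>\<in>UNIV. k $ \<alpha> * (\<Sum>i\<in>UNIV. \<nu> $ i * (f i \<alpha> + g i \<alpha>)))
      = (\<Sum>i\<in>UNIV. \<nu> $ i * ((\<Sum>\<alpha>\<in>UNIV. k $ \<alpha> * f i \<alpha>) + (\<Sum>\<alpha>\<in>UNIV. k $ \<alpha> * g i \<alpha>)))"
    for f g :: "'n \<Rightarrow> 'm \<Rightarrow> real"
    unfolding sum_distrib_left sum.distrib[symmetric]
    by (subst sum.swap) (simp add: algebra_simps)
  have "(\<Sum>\<alpha>\<in>UNIV. k $ \<alpha> * (\<Sum>j\<in>UNIV. c j * Bproj X j \<alpha> u))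
      = (\<Sum>j\<in>UNIV. supp_elem X u k $ j * c j)" for c
    unfolding sum_distrib_left
    by (subst sum.swap) (simp add: supp_elem_def sum_distrib_left sum_distrib_right mult_ac)
  moreover have "(\<Sum>\<alpha>\<in>UNIV. k $ \<alpha> * (\<Sum>\<beta>\<in>UNIV. Bproj2 X i \<beta> \<alpha> u * v $ \<beta>))
      = (\<Sum>\<alpha>\<in>UNIV. \<Sum>\<beta>\<in>UNIV. Bproj2 X i \<alpha> \<beta> u * (k $ \<alpha> * v $ \<beta>))" for i
  proof -
    have "(\<Sum>\<alpha>\<in>UNIV. k $ \<alpha> * (\<Sum>\<beta>\<in>UNIV. Bproj2 X i \<beta> \<alpha> u * v $ \<beta>))
        = (\<Sum>\<alpha>\<in>UNIV. k $ \<alpha> * (\<Sum>\<beta>\<in>UNIV. Bproj2 X i \<alpha> \<beta> u * v $ \<beta>))"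
      by (intro sum.cong refl arg_cong2[where f = "(*)"] B2_sym)
    then show ?thesis by (simp add: sum_distrib_left mult.left_commute)
  qed
  ultimately show ?thesis unfolding conormal_curv_def swap by simp
qed

lemma conormal_accel_eq:
  assumes "(X u, supp_elem X u v) \<in> S"
  shows "conormal_accel L X u \<nu> v = (\<Sum>\<alpha>\<in>UNIV. v $ \<alpha> * conormal_curv L X u \<nu> v \<alpha>)"
  unfolding conormal_curv_contract nonlin_supp[OF assms] conormal_accel_def ..

text \<open>Differentiation in \<open>v\<close> recovers the whole curvature vector from its
  contraction with \<open>v\<close>. The covector \<open>\<nu>\<close> is constant in
  \<open>v\<close> and contributes nothing.\<close>

lemma has_derivative_conormal_accel:
  assumes "(X u, supp_elem X u v) \<in> S"
  shows "(conormal_accel L X u \<nu> has_derivative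
    (\<lambda>k. 2 * (\<Sum>\<alpha>\<in>UNIV. k $ \<alpha> * conormal_curv L X u \<nu> v \<alpha>))) (at v)"
proof -
  let ?nl = "\<lambda>i j. nonlin L i j (X u) (supp_elem X u v)"
  let ?q = "\<lambda>i k. \<Sum>\<alpha>\<in>UNIV. \<Sum>\<beta>\<in>UNIV. Bproj2 X i \<alpha> \<beta> u * (v $ \<alpha> * k $ \<beta> + k $ \<alpha> * v $ \<beta>)"
  have sp: "((\<lambda>v. spray L i (X u) (supp_elem X u v)) has_derivative
      (\<lambda>k. \<Sum>j\<in>UNIV. supp_elem X u k $ j * ?nl i j)) (at v)" for i
    unfolding nonlin_def dy_def
    by (rule has_derivative_compose[OF bounded_linear_imp_has_derivative[OF bounded_linear_supp_elem]
          has_derivative_partial[OF differentiable_spray[OF assms]]])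
  have q: "((\<lambda>v. \<Sum>\<alpha>\<in>UNIV. \<Sum>\<beta>\<in>UNIV. Bproj2 X i \<alpha> \<beta> u * (v $ \<alpha> * v $ \<beta>)) has_derivative ?q i) (at v)" for i
    by (intro has_derivative_sum has_derivative_mult_right has_derivative_mult
        bounded_linear_imp_has_derivative bounded_linear_vec_nth)
  have "(conormal_accel L X u \<nu> has_derivative (\<lambda>k. \<Sum>i\<in>UNIV. \<nu> $ i *
      (?q i k + 2 * (\<Sum>j\<in>UNIV. supp_elem X u k $ j * ?nl i j)))) (at v)"
    unfolding conormal_accel_def[abs_def]
    by (intro has_derivative_sum has_derivative_mult_right has_derivative_add sp q)
  moreover have "?q i k = 2 * (\<Sum>\<alpha>\<in>UNIV. \<Sum>\<beta>\<in>UNIV. Bproj2 X i \<alpha> \<beta> u * (k $ \<alpha> * v $ \<beta>))" for i k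
  proof -
    have "(\<Sum>\<alpha>\<in>UNIV. \<Sum>\<beta>\<in>UNIV. Bproj2 X i \<alpha> \<beta> u * (v $ \<alpha> * k $ \<beta>))
        = (\<Sum>\<beta>\<in>UNIV. \<Sum>\<alpha>\<in>UNIV. Bproj2 X i \<beta> \<alpha> u * (k $ \<beta> * v $ \<alpha>))"
      by (subst sum.swap, intro sum.cong refl) (metis B2_sym mult.commute)
    then show ?thesis by (simp add: distrib_left sum.distrib)
  qed
  ultimately show ?thesis
    unfolding conormal_curv_contract
    by (simp add: sum_distrib_left[of 2] distrib_left mult.left_commute[of 2])
qed

text \<open>The equivalence of \<open>H_\<alpha> = 0\<close> and \<open>H_0 = 0\<close>: one
  direction contracts with \<open>v\<close>, the other differentiates a function vanishing on an
  open set of \<open>v\<close>.\<close>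

lemma normal_curv_iff_conormal_accel:
  "(\<forall>v N. (X u, supp_elem X u v) \<in> S \<and> unit_normal L X u v N \<longrightarrow> (\<forall>\<alpha>. normal_curv L X u v N \<alpha> = 0))
    \<longleftrightarrow> (\<forall>v. (X u, supp_elem X u v) \<in> S \<longrightarrow> conormal_accel L X u \<nu> v = 0)" (is "?H \<longleftrightarrow> ?E")
proof -
  have nc: "normal_curv L X u v N \<alpha> = 0 \<longleftrightarrow> conormal_curv L X u \<nu> v \<alpha> = 0"
    if N: "unit_normal L X u v N" for v N \<alpha>
  proof -
    obtain \<kappa> where \<kappa>: "\<kappa> \<noteq> 0"
      "\<And>i. (\<Sum>j\<in>UNIV. gmet L i j (X u) (supp_elem X u v) * N $ j) = \<kappa> * \<nu> $ i"
      using unit_normal_covector[OF N] by blast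
    have "normal_curv L X u v N \<alpha> = \<kappa> * conormal_curv L X u \<nu> v \<alpha>"
      unfolding normal_curv_def \<kappa>(2) conormal_curv_def sum_distrib_left by (simp add: mult.assoc)
    with \<kappa>(1) show ?thesis by simp
  qed
  have "?H \<longleftrightarrow> (\<forall>v. (X u, supp_elem X u v) \<in> S \<longrightarrow> (\<forall>\<alpha>. conormal_curv L X u \<nu> v \<alpha> = 0))"
    using nc unit_normal_exists by metis
  also have "\<dots> \<longleftrightarrow> ?E"
  proof (intro iffI allI impI)
    fix v assume "\<forall>v. (X u, supp_elem X u v) \<in> S \<longrightarrow> (\<forall>\<alpha>. conormal_curv L X u \<nu> v \<alpha> = 0)"
      and "(X u, supp_elem X u v) \<in> S"
    then show "conormal_accel L X u \<nu> v = 0" by (simp add: conormal_accel_eq)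
  next
    fix v \<alpha> assume E: ?E and v: "(X u, supp_elem X u v) \<in> S"
    have "(conormal_accel L X u \<nu> has_derivative (\<lambda>k. 0)) (at v)"
      by (rule has_derivative_transform_within_open[OF has_derivative_const open_supp])
        (use v E in auto)
    from fun_cong[OF has_derivative_unique[OF has_derivative_conormal_accel[OF v] this], of "axis \<alpha> 1"]
    show "conormal_curv L X u \<nu> v \<alpha> = 0"
      by (simp add: axis_def if_distrib[of "\<lambda>c. c * _"] cong: if_cong)
  qed
  finally show ?thesis .
qed

end

locale kropina_conormal = kropina_chart S L b \<rho> T K + finsler_conormal S L X u \<nu>
  for S :: "((real^'n::finite) \<times> (real^'n)) set" and L b \<rho> T K
    and X :: "real^'m::finite \<Rightarrow> real^'n" and u \<nu> +
  assumes tangent: "(X u, supp_elem X u v) \<in> S \<Longrightarrow> unit_normal L X u v N \<Longrightarrow>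
      (\<Sum>i\<in>UNIV. b (X u) (supp_elem X u v) $ i * N $ i) = 0"
begin

sublocale K: finsler_conormal T K X u \<nu> ..

text \<open>The supporting element is tangent, so it is orthogonal to \<open>N\<close>.\<close>

lemma supp_normal:
  assumes xy: "(X u, supp_elem X u v) \<in> S" and N: "unit_normal L X u v N"
  shows "N \<noteq> 0"
    "(\<Sum>r\<in>UNIV. (\<Sum>s\<in>UNIV. gmet L r s (X u) (supp_elem X u v) * supp_elem X u v $ s) * N $ r) = 0"
proof -
  let ?g = "\<lambda>i j. gmet L i j (X u) (supp_elem X u v)" and ?y = "supp_elem X u v"
  show "N \<noteq> 0" using N by (auto simp: unit_normal_def)
  obtain \<kappa> where \<kappa>: "\<And>i. (\<Sum>j\<in>UNIV. ?g i j * N $ j) = \<kappa> * \<nu> $ i"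
    using unit_normal_covector[OF N] by blast
  have "(\<Sum>r\<in>UNIV. (\<Sum>s\<in>UNIV. ?g r s * ?y $ s) * N $ r)
      = (\<Sum>s\<in>UNIV. (\<Sum>r\<in>UNIV. ?g r s * N $ r) * ?y $ s)"
    unfolding sum_distrib_right by (subst sum.swap) (simp add: mult_ac)
  also have "\<dots> = (\<Sum>s\<in>UNIV. (\<Sum>r\<in>UNIV. ?g s r * N $ r) * ?y $ s)"
    by (simp add: gmet_sym[OF xy])
  also have "\<dots> = \<kappa> * (\<Sum>s\<in>UNIV. \<nu> $ s * ?y $ s)"
    unfolding \<kappa> by (simp add: sum_distrib_left mult_ac)
  finally show "(\<Sum>r\<in>UNIV. (\<Sum>s\<in>UNIV. ?g r s * ?y $ s) * N $ r) = 0"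
    by (simp add: conormal_supp)
qed

text \<open>The second derivatives of \<open>X\<close> do not involve the metric, so only the
  difference of the sprays on \<open>\<nu>\<close> matters.\<close>

lemma conormal_accel_kropina:
  assumes xy: "(X u, supp_elem X u v) \<in> T"
  shows "conormal_accel K X u \<nu> v = conormal_accel L X u \<nu> v"
proof -
  let ?y = "supp_elem X u v"
  have xyS: "(X u, ?y) \<in> S" using xy T_def by auto
  obtain N where N: "unit_normal L X u v N" using unit_normal_exists[OF xyS] .
  obtain \<kappa> where \<kappa>: "\<kappa> \<noteq> 0" "\<And>i. (\<Sum>j\<in>UNIV. gmet L i j (X u) ?y * N $ j) = \<kappa> * \<nu> $ i"
    using unit_normal_covector[OF N] by blast
  have "\<kappa> * (\<Sum>s\<in>UNIV. \<nu> $ s * (spray K s (X u) ?y - spray L s (X u) ?y)) = 0"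
    using spray_kropina[OF xy supp_normal[OF xyS N] tangent[OF xyS N]]
    unfolding \<kappa>(2) by (simp add: sum_distrib_left mult.assoc)
  with \<kappa>(1) show ?thesis
    by (simp add: conormal_accel_def distrib_left right_diff_distrib sum.distrib sum_subtractf
        mult.left_commute[of _ 2] sum_distrib_left[symmetric])
qed

text \<open>Where \<open>\<beta>\<close> vanishes its derivative along the hypersurface does not, since \<open>b\<close> is tangent and
  nonzero; so the supporting elements with \<open>\<beta> \<noteq> 0\<close> are dense.\<close>

lemma conormal_accel_iff:
  "(\<forall>v. (X u, supp_elem X u v) \<in> S \<longrightarrow> conormal_accel L X u \<nu> v = 0)
    \<longleftrightarrow> (\<forall>v. (X u, supp_elem X u v) \<in> T \<longrightarrow> conormal_accel K X u \<nu> v = 0)" (is "_ \<longleftrightarrow> ?K")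
proof (intro iffI allI impI)
  fix v assume "\<forall>v. (X u, supp_elem X u v) \<in> S \<longrightarrow> conormal_accel L X u \<nu> v = 0"
    and "(X u, supp_elem X u v) \<in> T"
  then show "conormal_accel K X u \<nu> v = 0" using T_def by (auto simp: conormal_accel_kropina)
next
  fix v assume K: ?K and xy: "(X u, supp_elem X u v) \<in> S"
  let ?y = "supp_elem X u v"
  show "conormal_accel L X u \<nu> v = 0"
  proof (rule ccontr)
    assume ne: "conormal_accel L X u \<nu> v \<noteq> 0"
    \<comment> \<open>On this open neighbourhood of \<open>v\<close> the function
      \<open>\<beta>\<close> must vanish, since elsewhere the accelerations for \<open>L\<close> and
      \<open>K\<close> agree. Hence the derivative of \<open>\<beta>\<close> along the hypersurface
      is zero at \<open>v\<close>.\<close>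
    define V where "V = {v. (X u, supp_elem X u v) \<in> S} \<inter> conormal_accel L X u \<nu> -` (- {0})"
    have "continuous_on {v. (X u, supp_elem X u v) \<in> S} (conormal_accel L X u \<nu>)"
      by (intro continuous_at_imp_continuous_on ballI)
        (use has_derivative_conormal_accel has_derivative_continuous in blast)
    then have "open V"
      unfolding V_def by (rule continuous_open_preimage[OF _ open_supp]) auto
    have "\<beta> (X u) (supp_elem X u v') = 0" if "v' \<in> V" for v'
    proof (rule ccontr)
      assume "\<beta> (X u) (supp_elem X u v') \<noteq> 0"
      then have "(X u, supp_elem X u v') \<in> T" using that T_def by (auto simp: V_def)
      then show False using K conormal_accel_kropina that by (auto simp: V_def)
    qed
    then have "((\<lambda>v. \<beta> (X u) (supp_elem X u v)) has_derivative (\<lambda>k. 0)) (at v)"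
      by (intro has_derivative_transform_within_open[OF has_derivative_const \<open>open V\<close>])
        (use xy ne in \<open>auto simp: V_def\<close>)
    moreover have "((\<lambda>v. \<beta> (X u) (supp_elem X u v)) has_derivative
        (\<lambda>k. \<Sum>j\<in>UNIV. supp_elem X u k $ j * dy j \<beta> (X u) ?y)) (at v)"
      unfolding dy_def
      by (rule has_derivative_compose[OF bounded_linear_imp_has_derivative[OF bounded_linear_supp_elem]
          has_derivative_partial[OF smooth_xy_differentiable_snd[OF smooth_beta xy]]])
    ultimately have "(\<Sum>j\<in>UNIV. supp_elem X u k $ j * dy j \<beta> (X u) ?y) = 0" for k
      using has_derivative_unique by (metis (no_types, lifting))
    from this[of "axis _ 1"] have "(\<Sum>j\<in>UNIV. b (X u) ?y $ j * Bproj X j \<alpha> u) = 0" for \<alpha>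
      by (simp add: dy_beta[OF xy] supp_elem_axis mult.commute)
    \<comment> \<open>So \<open>b\<close> is conormal. Tangency then forces \<open>c = 0\<close>,
      because \<open>\<nu>\<close> does not vanish on \<open>N\<close>.\<close>
    then obtain c where c: "b (X u) ?y = c *\<^sub>R \<nu>" using annihilator by blast
    obtain N where N: "unit_normal L X u v N" using unit_normal_exists[OF xy] .
    obtain \<kappa> where \<kappa>: "\<kappa> * (\<Sum>i\<in>UNIV. \<nu> $ i * N $ i) = 1"
      using unit_normal_covector[OF N] by blast
    have "c * (\<Sum>i\<in>UNIV. \<nu> $ i * N $ i) = 0"
      using tangent[OF xy N] by (simp add: c sum_distrib_left mult.assoc)
    then have "b (X u) ?y = 0" using \<kappa> c by auto
    with b_nonzero_normal[OF xy supp_normal[OF xy N]] show False by contradiction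
  qed
qed

lemma normal_curv_iff:
  "(\<forall>v N. (X u, supp_elem X u v) \<in> S \<and> unit_normal L X u v N \<longrightarrow> (\<forall>\<alpha>. normal_curv L X u v N \<alpha> = 0))
   \<longleftrightarrow> (\<forall>v N. (X u, supp_elem X u v) \<in> T \<and> unit_normal K X u v N \<longrightarrow> (\<forall>\<alpha>. normal_curv K X u v N \<alpha> = 0))"
  using normal_curv_iff_conormal_accel K.normal_curv_iff_conormal_accel conormal_accel_iff by simp

end

text \<open>Openness is what the symmetry of the second derivatives of the parametrization rests
  on.\<close>

lemma open_param_domain:
  assumes "smooth_atlas A" "smooth_atlas A'" "continuous_on UNIV \<iota>" "c \<in> A" "d \<in> A'"
  shows "open (param_domain \<iota> c d)"
proof -
  have c: "open (fst c)" and d: "open (fst d)" "open (snd d ` fst d)"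
    "homeomorphism (fst d) (snd d ` fst d) (snd d) (chart_inv d)"
    using assms unfolding smooth_atlas_def by auto
  have "open (fst d \<inter> \<iota> -` fst c)"
    using c d(1) assms(3) by (intro open_Int open_vimage)
  then have "openin (top_of_set (fst d)) (fst d \<inter> \<iota> -` fst c)"
    using d(1) by (simp add: openin_open_eq)
  then have "openin (top_of_set (snd d ` fst d)) (param_domain \<iota> c d)"
    unfolding param_domain_def by (rule homeomorphism_imp_open_map[OF d(3)])
  then show ?thesis using d(2) openin_open_trans by blast
qed

theorem theorem4p2:
  fixes A :: "('p::{t2_space,second_countable_topology}, 'n::finite) chart set"
    and A' :: "('q::{t2_space,second_countable_topology}, 'm::finite) chart set"
    and \<iota> :: "'q \<Rightarrow> 'p"
    and D :: "('p, 'n) chart \<Rightarrow> ((real^'n) \<times> (real^'n)) set"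
    and L :: "('p, 'n) chart \<Rightarrow> real^'n \<Rightarrow> real^'n \<Rightarrow> real"
    and b :: "('p, 'n) chart \<Rightarrow> real^'n \<Rightarrow> real^'n \<Rightarrow> real^'n"
  assumes "finsler_space A D L"
    and "h_vector A D L b"
    and "finsler_space A (kropina_domain D b) (kropina_metric L b)"
    and "hypersurface A A' \<iota>"
    and "gradient_covector A D L b"
    and "tangent_to_hypersurface A A' \<iota> D L b"
  shows "hyperplane_first_kind A A' \<iota> D L \<longleftrightarrow>
         hyperplane_first_kind A A' \<iota> (kropina_domain D b) (kropina_metric L b)"
proof -
  let ?T = "kropina_domain D b" and ?K = "kropina_metric L b"
  obtain \<rho> where \<rho>: "\<forall>c\<in>A. \<forall>(x, y)\<in>D c. \<rho> c x y \<noteq> 0 \<and>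
      (\<forall>i j. L c x y * (\<Sum>h\<in>UNIV. Cup (L c) h i j x y * b c x y $ h) = \<rho> c x y * hang (L c) i j x y)"
    using assms(2) unfolding h_vector_def by blast
  have kropina: "kropina_chart (D c) (L c) (b c) (\<rho> c) (?T c) (?K c)" if c: "c \<in> A" for c
  proof -
    interpret finsler_chart "D c" "L c"
      using assms(1) c unfolding finsler_space_def conic_domain_def
      by unfold_locales (auto simp: conic_def)
    interpret h_vector_chart "D c" "L c" "b c" "\<rho> c"
    proof
      fix x y i j assume xy: "(x, y) \<in> D c"
      have "D c \<subseteq> (snd c ` fst c) \<times> (- {0})"
        using assms(1) c unfolding finsler_space_def conic_domain_def by blast
      with xy show "y \<noteq> 0" by auto
      show "vcov (L c) (b c) i j x y = 0"
        using assms(2) c xy unfolding h_vector_def by blast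
      show "L c x y * (\<Sum>h\<in>UNIV. Cup (L c) h i j x y * b c x y $ h) = \<rho> c x y * hang (L c) i j x y"
        "\<rho> c x y \<noteq> 0"
        using \<rho> c xy by blast+
      show "hcov (L c) (b c) i j x y = hcov (L c) (b c) j i x y"
        using assms(5) c xy unfolding gradient_covector_def by blast
    next
      show "smooth_on (D c) (\<lambda>(x, y). b c x y)"
        using assms(2) c unfolding h_vector_def covector_field_def by blast
    qed
    interpret K: finsler_chart "?T c" "?K c"
      using assms(3) c unfolding finsler_space_def conic_domain_def
      by unfold_locales (auto simp: conic_def)
    show ?thesis
      by unfold_locales (simp_all add: kropina_domain_def kropina_metric_def \<beta>_def)
  qed
  \<comment> \<open>The two hyperplane conditions are compared at each point \<open>u\<close>
    separately, for all \<open>v\<close> at once: differentiation in \<open>v\<close> and the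
    density argument both need \<open>v\<close> to vary.\<close>
  have "(\<forall>v N. (param \<iota> c d u, supp_elem (param \<iota> c d) u v) \<in> D c \<and>
        unit_normal (L c) (param \<iota> c d) u v N \<longrightarrow>
        (\<forall>\<alpha>. normal_curv (L c) (param \<iota> c d) u v N \<alpha> = 0)) \<longleftrightarrow>
      (\<forall>v N. (param \<iota> c d u, supp_elem (param \<iota> c d) u v) \<in> ?T c \<and>
        unit_normal (?K c) (param \<iota> c d) u v N \<longrightarrow>
        (\<forall>\<alpha>. normal_curv (?K c) (param \<iota> c d) u v N \<alpha> = 0))"
    if c: "c \<in> A" and d: "d \<in> A'" and u: "u \<in> param_domain \<iota> c d" for c d u
  proof -
    let ?X = "param \<iota> c d"
    have X: "smooth_on (param_domain \<iota> c d) ?X" "rank (\<chi> i \<alpha>. Bproj ?X i \<alpha> u) = CARD('m)"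
      "CARD('n) = CARD('m) + 1" "smooth_atlas A'" "continuous_on UNIV \<iota>"
      using assms(4) c d u unfolding hypersurface_def by blast+
    have op: "open (param_domain \<iota> c d)"
      using open_param_domain[OF _ X(4,5) c d] assms(1) unfolding finsler_space_def by blast
    obtain \<nu> where \<nu>: "\<nu> \<noteq> 0"
      "\<And>w. (\<forall>\<alpha>. (\<Sum>i\<in>UNIV. w $ i * (\<chi> i \<alpha>. Bproj ?X i \<alpha> u) $ i $ \<alpha>) = 0) \<longleftrightarrow> (\<exists>c. w = c *\<^sub>R \<nu>)"
      using annihilator_line[OF X(2,3)] by blast
    interpret kropina_chart "D c" "L c" "b c" "\<rho> c" "?T c" "?K c" by (rule kropina[OF c])
    interpret conormal ?X u \<nu>
      using \<nu> Bproj2_sym[OF op X(1) u] by unfold_locales simp_all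
    interpret kropina_conormal "D c" "L c" "b c" "\<rho> c" "?T c" "?K c" ?X u \<nu>
      using assms(6) c d u unfolding tangent_to_hypersurface_def by unfold_locales blast
    show ?thesis by (rule normal_curv_iff)
  qed
  then show ?thesis unfolding hyperplane_first_kind_def by (intro ball_cong refl)
qed

end
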